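(* Let $\mathbb{K}$ be the real or complex field. (1) Let $r\in[2,\infty)$, let $m\ge1$ be an integer, let $p_1,\dots,p_m\in(r,\infty]$ satisfy $\frac1{p_1}+\cdots+\frac1{p_m}<\frac1r$, and let $q_1,\dots,q_m>0$ satisfy $$q_k\ge\frac{r}{1-\left(\frac1{p_k}+\cdots+\frac1{p_m}\right)r}\quad\text{for every }k=1,\dots,m.$$ Then the optimal (smallest) constant $C\ge1$ such that $$\left(\sum_{j_1=1}^\infty\left(\sum_{j_2=1}^\infty\cdots\left(\sum_{j_m=1}^\infty\|A(e_{j_1},\dots,e_{j_m})\|_{\ell_r}^{q_m}\right)^{\frac{q_{m-1}}{q_m}}\cdots\right)^{\frac{q_1}{q_2}}\right)^{\frac1{q_1}}\le C\|A\|$$ for all continuous $m$-linear operators $A:\ell_{p_1}\times\cdots\times\ell_{p_m}\to\ell_r$ is $C=1$. (2) Let $m\ge2$ be an integer, let $1<p_m\le2<p_1,\dots,p_{m-1}$ (the value $\infty$ being allowed for $p_1,\dots,p_{m-1}$) satisfy $\frac1{p_1}+\cdots+\frac1{p_m}<1$, and let $q_1,\dots,q_m>0$ satisfy $$q_k\ge\frac1{1-\left(\frac1{p_k}+\cdots+\frac1{p_m}\right)}\quad\text{for every }k=1,\dots,m.$$ Then the optimal (smallest) constant $C\ge1$ such that $$\left(\sum_{j_1=1}^\infty\left(\sum_{j_2=1}^\infty\cdots\left(\sum_{j_m=1}^\infty|A(e_{j_1},\dots,e_{j_m})|^{q_m}\right)^{\frac{q_{m-1}}{q_m}}\cdots\right)^{\frac{q_1}{q_2}}\right)^{\frac1{q_1}}\le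 C\|A\|$$ for all continuous $m$-linear forms $A:\ell_{p_1}\times\cdots\times\ell_{p_m}\to\mathbb{K}$ is $C=1$.
   Context: All sequence spaces are over $\mathbb{K}$. Convention: when $p=\infty$, the domain space $\ell_\infty$ is replaced by $c_0$, and $1/\infty=0$. $(e_k)_{k\ge1}$ denotes the sequence of canonical vectors of $\ell_p$. $\|A\|$ is the usual supremum norm of a continuous $m$-linear operator over the product of closed unit balls. For $m=1$ the iterated sum is $\left(\sum_j\|A(e_j)\|^{q_1}\right)^{1/q_1}$. *)

theory Defs
  imports "HOL-Analysis.Analysis" "HOL-Library.Function_Algebras"
begin

section \<open>Sequence spaces\<close>

text \<open>Sequences are indexed from \<open>0\<close> instead of \<open>1\<close>. The exponent \<open>\<infinity>\<close> stands for the space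
  \<open>c\<^sub>0\<close> of null sequences with the supremum norm, not for the space of bounded sequences.\<close>

definition ell :: "ereal \<Rightarrow> (nat \<Rightarrow> 'a::real_normed_field) set" where
  "ell p = (if p = \<infinity> then {x. x \<longlonglongrightarrow> 0}
            else {x. summable (\<lambda>j. norm (x j) powr real_of_ereal p)})"

definition ell_norm :: "ereal \<Rightarrow> (nat \<Rightarrow> 'a::real_normed_field) \<Rightarrow> real" where
  "ell_norm p x = (if p = \<infinity> then (SUP j. norm (x j))
                   else (\<Sum>j. norm (x j) powr real_of_ereal p) powr (1 / real_of_ereal p))"

definition ell_topology :: "ereal \<Rightarrow> (nat \<Rightarrow> 'a::real_normed_field) topology" where
  "ell_topology p = Metric_space.mtopology (ell p) (\<lambda>x y. \<bar>ell_norm p (x - y)\<bar>)"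

definition seq_scale :: "'a::real_normed_field \<Rightarrow> (nat \<Rightarrow> 'a) \<Rightarrow> nat \<Rightarrow> 'a" where
  "seq_scale c x = (\<lambda>j. c * x j)"

definition unit_seq :: "nat \<Rightarrow> nat \<Rightarrow> 'a::real_normed_field" where
  "unit_seq j = (\<lambda>i. if i = j then 1 else 0)"

text \<open>\<open>Metric_space.mtopology\<close> is only meaningful for a genuine metric, so we check below that
  \<open>ell_norm p\<close> induces one on \<open>ell p\<close> whenever \<open>1 \<le> p\<close>. The absolute value above has no effect on
  \<open>ell p\<close>: \<^locale>\<open>Metric_space\<close> wants the distance to be nonnegative on the whole type, where the
  supremum of an unbounded sequence is unspecified.\<close>

lemma powr_convex_nonneg:
  fixes a b t p :: real
  assumes "0 \<le> a" "0 \<le> b" "0 < t" "t < 1" "1 \<le> p"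
  shows "(t * a + (1 - t) * b) powr p \<le> t * a powr p + (1 - t) * b powr p"
proof -
  have le: "s powr p \<le> s" if "0 < s" "s < 1" for s :: real
    using powr_mono'[of 1 p s] that assms by simp
  consider "a = 0" | "b = 0" | "0 < a" "0 < b" using assms by linarith
  then show ?thesis
  proof cases
    case 1
    then show ?thesis using le[of "1 - t"] assms
      by (simp add: powr_mult mult_right_mono)
  next
    case 2
    then show ?thesis using le[of t] assms
      by (simp add: powr_mult mult_right_mono)
  next
    case 3
    then show ?thesis
      using convex_onD[OF powr_convex[OF assms(5)], of "1 - t" a b] assms by simp
  qed
qed

lemma ell_PInf_bdd: "x \<in> ell \<infinity> \<Longrightarrow> bdd_above (range (\<lambda>j. norm (x j)))"
proof -
  assume "x \<in> ell \<infinity>"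
  then have "Bseq x" by (auto simp: ell_def intro: convergent_imp_Bseq convergentI)
  then obtain K where "\<forall>n. norm (x n) \<le> K" unfolding Bseq_def by blast
  then show ?thesis by (auto intro!: bdd_aboveI)
qed

lemma ell_PInf_le: "x \<in> ell \<infinity> \<Longrightarrow> norm (x j) \<le> (SUP j. norm (x j))"
  by (rule cSUP_upper[OF UNIV_I ell_PInf_bdd])

lemma ell_triangle:
  assumes "1 \<le> p" "x \<in> ell p" "y \<in> ell p"
  shows "x + y \<in> ell p \<and> ell_norm p (x + y) \<le> ell_norm p x + ell_norm p y"
proof (cases "p = \<infinity>")
  case True
  have "x + y \<in> ell p" using assms True tendsto_add[of x 0 sequentially y 0]
    by (simp add: ell_def plus_fun_def)
  moreover have "norm (x j + y j) \<le> (SUP j. norm (x j)) + (SUP j. norm (y j))" for j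
    using ell_PInf_le[of x j] ell_PInf_le[of y j] assms True norm_triangle_ineq[of "x j" "y j"]
    by simp
  ultimately show ?thesis using True by (auto simp: ell_norm_def intro!: cSUP_least)
next
  case False
  then obtain s where p: "p = ereal s" and s: "1 \<le> s" using assms(1) by (cases p) auto
  define X Y where "X = (\<Sum>j. norm (x j) powr s)" and "Y = (\<Sum>j. norm (y j) powr s)"
  have sx: "summable (\<lambda>j. norm (x j) powr s)" and sy: "summable (\<lambda>j. norm (y j) powr s)"
    using assms p by (auto simp: ell_def)
  define a b where "a = X powr (1/s)" and "b = Y powr (1/s)"
  have X0: "0 \<le> X" and Y0: "0 \<le> Y" 
    unfolding X_def Y_def by (simp_all add: suminf_nonneg sx sy)
  have ab0: "0 \<le> a" "0 \<le> b" by (simp_all add: a_def b_def)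
  have as: "a powr s = X" and bs: "b powr s = Y"
    using X0 Y0 s by (auto simp: a_def b_def powr_powr)
  have key: "summable (\<lambda>j. norm (x j + y j) powr s)
      \<and> (\<Sum>j. norm (x j + y j) powr s) \<le> (a' + b') powr s"
    if a': "0 < a'" "a \<le> a'" and b': "0 < b'" "b \<le> b'" for a' b'
  proof -
    define t where "t = a' / (a' + b')"
    have t: "0 < t" "t < 1" and t1: "1 - t = b' / (a' + b')" using that by (auto simp: t_def field_simps)
    define g where "g = (\<lambda>j. (a' + b') powr s * (t * (norm (x j) powr s / a' powr s)
                          + (1 - t) * (norm (y j) powr s / b' powr s)))"
    have le: "norm (x j + y j) powr s \<le> g j" for j
    proof -
      have "norm (x j + y j) powr s \<le> (norm (x j) + norm (y j)) powr s"
        using s by (intro powr_mono2 norm_triangle_ineq) auto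
      also have "norm (x j) + norm (y j)
          = (a' + b') * (t * (norm (x j) / a') + (1 - t) * (norm (y j) / b'))"
      proof -
        have "(a' + b') * t = a'" "(a' + b') * (1 - t) = b'"
          unfolding t1 unfolding t_def using that by auto
        then have "(a' + b') * (t * (norm (x j) / a') + (1 - t) * (norm (y j) / b'))
            = a' * (norm (x j) / a') + b' * (norm (y j) / b')"
          by (metis distrib_left mult.assoc)
        then show ?thesis using that by simp
      qed
      also have "\<dots> powr s = (a' + b') powr s *
          (t * (norm (x j) / a') + (1 - t) * (norm (y j) / b')) powr s"
        using that t by (intro powr_mult) 
      also have "\<dots> \<le> g j"
        unfolding g_def
        using powr_convex_nonneg[of "norm (x j) / a'" "norm (y j) / b'" t s] that t s
        by (intro mult_left_mono) (auto simp: powr_divide)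
      finally show ?thesis .
    qed
    have gs: "g sums ((a' + b') powr s * (t * (X / a' powr s) + (1 - t) * (Y / b' powr s)))"
      unfolding g_def X_def Y_def
      by (rule sums_mult[OF sums_add[OF sums_mult[OF sums_divide[OF summable_sums[OF sx]]]
            sums_mult[OF sums_divide[OF summable_sums[OF sy]]]]])
    have sm: "summable (\<lambda>j. norm (x j + y j) powr s)"
      by (rule summable_comparison_test'[OF sums_summable[OF gs], of 0]) (use le in simp)
    have "X \<le> a' powr s" "Y \<le> b' powr s"
      using powr_mono2[of s a a'] powr_mono2[of s b b'] that(2,4) s ab0 as bs by simp_all
    then have "X / a' powr s \<le> 1" "Y / b' powr s \<le> 1"
      using that by simp_all
    then have "t * (X / a' powr s) + (1 - t) * (Y / b' powr s) \<le> t * 1 + (1 - t) * 1"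
      using t by (intro add_mono mult_left_mono) auto
    then have "(a' + b') powr s * (t * (X / a' powr s) + (1 - t) * (Y / b' powr s)) \<le> (a' + b') powr s * 1"
      by (intro mult_left_mono) auto
    moreover have "(\<Sum>j. norm (x j + y j) powr s)
        \<le> (a' + b') powr s * (t * (X / a' powr s) + (1 - t) * (Y / b' powr s))"
      using suminf_le[OF le sm sums_summable[OF gs]] sums_unique[OF gs] by simp
    ultimately show ?thesis using sm by linarith
  qed
  have sm: "summable (\<lambda>j. norm (x j + y j) powr s)"
    using key[of "a + 1" "b + 1"] ab0 by simp
  have S0: "0 \<le> (\<Sum>j. norm (x j + y j) powr s)" by (rule suminf_nonneg[OF sm]) simp
  have "(\<Sum>j. norm (x j + y j) powr s) powr (1/s) \<le> a + b + e" if "0 < e" for e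
  proof -
    have "(\<Sum>j. norm (x j + y j) powr s) powr (1/s) \<le> ((a + e/2 + (b + e/2)) powr s) powr (1/s)"
      using key[of "a + e/2" "b + e/2"] ab0 that S0 s by (intro powr_mono2) auto
    also have "\<dots> = a + b + e" using ab0 that s by (simp add: powr_powr)
    finally show ?thesis .
  qed
  then have "(\<Sum>j. norm (x j + y j) powr s) powr (1/s) \<le> a + b" by (rule field_le_epsilon)
  then show ?thesis using sm p by (simp add: ell_def ell_norm_def a_def b_def X_def Y_def)
qed

lemma ell_uminus: "x \<in> ell p \<Longrightarrow> - x \<in> ell p"
  using tendsto_minus[of x 0 sequentially] by (auto simp: ell_def fun_Compl_def)

lemma ell_norm_minus: "ell_norm p (- x) = ell_norm p x"
  by (simp add: ell_norm_def)

lemma ell_norm_nonneg: "x \<in> ell p \<Longrightarrow> 0 \<le> ell_norm p x"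
  using order_trans[OF norm_ge_zero ell_PInf_le[of x 0]] by (auto simp: ell_norm_def)

lemma ell_norm_eq_0:
  fixes x :: "nat \<Rightarrow> 'a::real_normed_field"
  assumes "1 \<le> p" "x \<in> ell p"
  shows "ell_norm p x = 0 \<longleftrightarrow> x = 0"
proof (cases "p = \<infinity>")
  case True
  then have le: "norm (x j) \<le> ell_norm p x" for j
    using ell_PInf_le[of x j] assms by (simp add: ell_norm_def)
  have "x = 0" if "ell_norm p x = 0" using le that by (simp add: fun_eq_iff)
  moreover have "ell_norm p (0 :: nat \<Rightarrow> 'a) = 0" using True by (simp add: ell_norm_def)
  ultimately show ?thesis by blast
next
  case False
  then obtain s where p: "p = ereal s" and s: "1 \<le> s" using assms(1) by (cases p) auto
  then show ?thesis using assms suminf_eq_zero_iff[of "\<lambda>j. norm (x j) powr s"]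
    by (auto simp: ell_def ell_norm_def fun_eq_iff)
qed

lemma Metric_space_ell:
  assumes "1 \<le> p"
  shows "Metric_space (ell p :: (nat \<Rightarrow> 'a::real_normed_field) set) (\<lambda>x y. \<bar>ell_norm p (x - y)\<bar>)"
proof
  have diff: "x - y \<in> ell p" if "x \<in> ell p" "y \<in> ell p" for x y :: "nat \<Rightarrow> 'a"
    using ell_triangle[OF assms, of x "- y"] that ell_uminus[of y p] by simp
  show "0 \<le> \<bar>ell_norm p (x - y)\<bar>" for x y :: "nat \<Rightarrow> 'a"
    by simp
  show "\<bar>ell_norm p (x - y)\<bar> = \<bar>ell_norm p (y - x)\<bar>" for x y :: "nat \<Rightarrow> 'a"
    using ell_norm_minus[of p "x - y"] by simp
  show "\<bar>ell_norm p (x - y)\<bar> = 0 \<longleftrightarrow> x = y" if "x \<in> ell p" "y \<in> ell p" for x y :: "nat \<Rightarrow> 'a"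
    using ell_norm_eq_0[OF assms diff[OF that]] by simp
  show "\<bar>ell_norm p (x - z)\<bar> \<le> \<bar>ell_norm p (x - y)\<bar> + \<bar>ell_norm p (y - z)\<bar>"
    if "x \<in> ell p" "y \<in> ell p" "z \<in> ell p" for x y z :: "nat \<Rightarrow> 'a"
  proof -
    have "x - y + (y - z) = x - z" by (simp add: fun_eq_iff)
    then have "ell_norm p (x - z) \<le> ell_norm p (x - y) + ell_norm p (y - z)"
      using ell_triangle[OF assms diff[OF that(1,2)] diff[OF that(2,3)]] by metis
    then show ?thesis using ell_norm_nonneg[OF diff[OF that(1,3)]] by linarith
  qed
qed


section \<open>Continuous multilinear maps\<close>

text \<open>The arguments of an \<open>m\<close>-linear map are the extensional tuples in
  \<open>PiE {1..m} (\<lambda>k. ell (p k))\<close>, on which \<^const>\<open>product_topology\<close> lives. The codomain is given by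
  its topology \<open>T\<close> and its scalar multiplication \<open>scl\<close>, so that both \<open>ell r\<close> and the scalar field
  are covered.\<close>

definition continuous_multilinear ::
  "nat \<Rightarrow> (nat \<Rightarrow> ereal) \<Rightarrow> 'b::plus topology \<Rightarrow> ('a::real_normed_field \<Rightarrow> 'b \<Rightarrow> 'b)
    \<Rightarrow> ((nat \<Rightarrow> nat \<Rightarrow> 'a) \<Rightarrow> 'b) \<Rightarrow> bool" where
  "continuous_multilinear m p T scl A \<longleftrightarrow>
     continuous_map (product_topology (\<lambda>k. ell_topology (p k)) {1..m}) T A \<and>
     (\<forall>x \<in> PiE {1..m} (\<lambda>k. ell (p k)). \<forall>k\<in>{1..m}. \<forall>u \<in> ell (p k). \<forall>v \<in> ell (p k). \<forall>c.
        A (x(k := u + v)) = A (x(k := u)) + A (x(k := v)) \<and>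
        A (x(k := seq_scale c u)) = scl c (A (x(k := u))))"

definition multilinear_norm ::
  "nat \<Rightarrow> (nat \<Rightarrow> ereal) \<Rightarrow> ('b \<Rightarrow> real) \<Rightarrow> ((nat \<Rightarrow> nat \<Rightarrow> 'a::real_normed_field) \<Rightarrow> 'b) \<Rightarrow> real" where
  "multilinear_norm m p N A =
     (SUP x \<in> PiE {1..m} (\<lambda>k. {u \<in> ell (p k). ell_norm (p k) u \<le> 1}). N (A x))"


section \<open>Iterated sums and optimal constants\<close>

text \<open>Sums take values in \<open>[0, \<infinity>]\<close>, so an upper bound by a real number entails convergence.\<close>

definition epowr :: "ennreal \<Rightarrow> real \<Rightarrow> ennreal" where
  "epowr x a = (if x = \<infinity> then \<infinity> else ennreal (enn2real x powr a))" \<comment> \<open>for \<open>a > 0\<close>\<close>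

text \<open>\<open>iterated_sum [q\<^sub>1, \<dots>, q\<^sub>m] f\<close> is
  \<open>\<Sum>\<^bsub>j\<^sub>1\<^esub> (\<Sum>\<^bsub>j\<^sub>2\<^esub> \<dots> (\<Sum>\<^bsub>j\<^sub>m\<^esub> f [j\<^sub>1, \<dots>, j\<^sub>m]\<^bsup>q\<^sub>m\<^esup>)\<^bsup>q\<^sub>m\<^sub>-\<^sub>1/q\<^sub>m\<^esup> \<dots>)\<^bsup>q\<^sub>1/q\<^sub>2\<^esup>\<close>,
  without the outermost exponent \<open>1/q\<^sub>1\<close>.\<close>

fun iterated_sum :: "real list \<Rightarrow> (nat list \<Rightarrow> ennreal) \<Rightarrow> ennreal" where
  "iterated_sum [] f = f []"
| "iterated_sum [q] f = (\<Sum>j. epowr (f [j]) q)"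
| "iterated_sum (q # q' # qs) f =
     (\<Sum>j. epowr (iterated_sum (q' # qs) (\<lambda>js. f (j # js))) (q / q'))"

definition unit_tuple :: "nat \<Rightarrow> nat list \<Rightarrow> nat \<Rightarrow> nat \<Rightarrow> 'a::real_normed_field" where
  "unit_tuple m js = (\<lambda>k\<in>{1..m}. unit_seq (js ! (k - 1)))"

definition admissible_constants ::
  "nat \<Rightarrow> (nat \<Rightarrow> ereal) \<Rightarrow> (nat \<Rightarrow> real) \<Rightarrow> 'b::plus topology \<Rightarrow> ('b \<Rightarrow> real)
    \<Rightarrow> ('a::real_normed_field \<Rightarrow> 'b \<Rightarrow> 'b) \<Rightarrow> real set" where
  "admissible_constants m p q T N scl =
     {C. 1 \<le> C \<and>
         (\<forall>A. continuous_multilinear m p T scl A \<longrightarrow>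
            epowr (iterated_sum (map q [1..<Suc m]) (\<lambda>js. ennreal (N (A (unit_tuple m js))))) (1 / q 1)
              \<le> ennreal (C * multilinear_norm m p N A))}"

definition is_optimal_constant :: "real set \<Rightarrow> real \<Rightarrow> bool" where
  "is_optimal_constant S C \<longleftrightarrow> C \<in> S \<and> (\<forall>C'\<in>S. C \<le> C')"

definition operator_constants ::
  "'a::real_normed_field itself \<Rightarrow> nat \<Rightarrow> (nat \<Rightarrow> ereal) \<Rightarrow> (nat \<Rightarrow> real) \<Rightarrow> real \<Rightarrow> real set" where
  "operator_constants K m p q r =
     admissible_constants m p q (ell_topology (ereal r)) (ell_norm (ereal r))
       (seq_scale :: 'a \<Rightarrow> (nat \<Rightarrow> 'a) \<Rightarrow> nat \<Rightarrow> 'a)"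

definition form_constants ::
  "'a::real_normed_field itself \<Rightarrow> nat \<Rightarrow> (nat \<Rightarrow> ereal) \<Rightarrow> (nat \<Rightarrow> real) \<Rightarrow> real set" where
  "form_constants K m p q =
     admissible_constants m p q euclidean norm ((*) :: 'a \<Rightarrow> 'a \<Rightarrow> 'a)"

end

theory Submission
  imports Defs
begin

text \<open>The constant \<open>1\<close> is optimal as soon as it is admissible, since only constants \<open>C \<ge> 1\<close> compete. So the
  task is to prove the inequality with constant \<open>1\<close>.

  For one argument and an operator \<open>A\<close> from \<open>\<ell>\<^sub>p\<close> to \<open>\<ell>\<^sub>r\<close> with \<open>2 \<le> r < p\<close>, the space \<open>\<ell>\<^sub>r\<close> has cotype \<open>r\<close> with
  constant \<open>1\<close>: suitable signs give \<open>\<Sum> \<parallel>y\<^sub>j\<parallel>\<^sup>r \<le> \<parallel>\<Sum> \<plusminus>y\<^sub>j\<parallel>\<^sup>r\<close>. With \<open>y\<^sub>j = b\<^sub>j A e\<^sub>j\<close> this reads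
  \<open>\<Sum> b\<^sub>j\<^sup>r \<parallel>A e\<^sub>j\<parallel>\<^sup>r \<le> \<parallel>A\<parallel>\<^sup>r\<close> for all nonnegative \<open>b\<close> in the unit ball of \<open>\<ell>\<^sub>p\<close>, and duality
  (\<open>holder_dual_bound\<close>) yields \<open>\<Sum> \<parallel>A e\<^sub>j\<parallel>\<^sup>s \<le> \<parallel>A\<parallel>\<^sup>s\<close> with \<open>1/s = 1/r - 1/p\<close>. For several arguments the step is
  iterated from the last argument to the first (\<open>multilinear_bound\<close>): when the last arguments have been
  treated, the operator takes values in a mixed-norm space \<open>\<ell>\<^sub>s\<^sub>k(\<dots>(\<ell>\<^sub>s\<^sub>m(\<ell>\<^sub>r)))\<close>, whose exponents decrease inwards
  and are at least \<open>2\<close>. Such a space has cotype \<open>s\<^sub>k\<close> with constant \<open>1\<close>. The reason is Clarkson's inequality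
  \<open>2 (\<parallel>x\<parallel>\<^sup>s + \<parallel>y\<parallel>\<^sup>s) \<le> \<parallel>x + y\<parallel>\<^sup>s + \<parallel>x - y\<parallel>\<^sup>s\<close>, which passes from the scalars to mixed norms
  (\<open>iterated_sum_clarkson\<close>) and lets the signs be chosen one at a time (\<open>greedy_signs\<close>).

  This gives the smallest exponents allowed. Larger ones only decrease the left-hand side
  (\<open>iterated_norm_antimono\<close>).

  A form whose last exponent is \<open>p\<^sub>m \<le> 2\<close> is an operator in the other arguments with values in the dual of
  \<open>\<ell>\<^bsub>p\<^sub>m\<^esub>\<close>, that is in \<open>\<ell>\<^sub>r\<close> with \<open>r = 1 / (1 - 1 / p\<^sub>m) \<ge> 2\<close>, so it is covered by the argument for operators.\<close>

section \<open>Powers of extended nonnegative reals\<close>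

lemma epowr_ennreal: "0 \<le> x \<Longrightarrow> epowr (ennreal x) a = ennreal (x powr a)"
  by (simp add: epowr_def)

lemma epowr_top: "epowr top a = top"
  by (simp add: epowr_def)

lemma epowr_mono: "x \<le> y \<Longrightarrow> 0 \<le> a \<Longrightarrow> epowr x a \<le> epowr y a"
  by (cases x; cases y) (auto simp: epowr_ennreal epowr_top top_unique powr_mono2 ennreal_leI)

lemma epowr_epowr: "epowr (epowr x a) b = epowr x (a * b)"
  by (cases x) (simp_all add: epowr_ennreal epowr_top powr_powr)

lemma epowr_mult_left: "0 \<le> t \<Longrightarrow> epowr (ennreal t * x) a = ennreal (t powr a) * epowr x a"
proof (cases x)
  case (real y)
  assume "0 \<le> t"
  with real show ?thesis by (simp add: epowr_ennreal powr_mult flip: ennreal_mult)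
next
  case top
  assume "0 \<le> t"
  with top show ?thesis
    by (cases "t = 0") (simp_all add: epowr_top ennreal_mult_top epowr_def)
qed

lemma powr_superadditive:
  fixes x y a :: real
  assumes "0 \<le> x" "0 \<le> y" "1 \<le> a"
  shows "x powr a + y powr a \<le> (x + y) powr a"
proof -
  have split: "z powr a = z * z powr (a - 1)" if "0 \<le> z" for z :: real
    using that by (cases "z = 0") (simp_all add: powr_mult_base)
  have "x powr a + y powr a \<le> x * (x + y) powr (a - 1) + y * (x + y) powr (a - 1)"
    using assms by (auto simp: split intro!: add_mono mult_left_mono powr_mono2)
  also have "\<dots> = (x + y) powr a"
    using assms by (simp add: split[of "x + y"] distrib_right)
  finally show ?thesis .
qed

lemma epowr_superadditive:
  assumes "1 \<le> a" shows "epowr x a + epowr y a \<le> epowr (x + y) a"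
  using assms
  by (cases x; cases y)
    (auto simp: epowr_ennreal epowr_top powr_superadditive simp flip: ennreal_plus)

text \<open>The embedding of \<open>\<ell>\<^sub>1\<close> into \<open>\<ell>\<^sub>a\<close> with constant \<open>1\<close>, in the form in which it makes iterated norms decrease
  when an exponent grows.\<close>

lemma suminf_epowr_le:
  assumes "1 \<le> a"
  shows "(\<Sum>j. epowr (f j) a) \<le> epowr (\<Sum>j. f j) a"
proof (rule suminf_le_const[OF summableI])
  fix n
  have "(\<Sum>j<n. epowr (f j) a) \<le> epowr (\<Sum>j<n. f j) a"
  proof (induction n)
    case (Suc n)
    then show ?case
      using epowr_superadditive[OF assms, of "\<Sum>j<n. f j" "f n"] by (auto intro: order_trans add_mono)
  qed simp
  also have "\<dots> \<le> epowr (\<Sum>j. f j) a"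
    using assms by (intro epowr_mono sum_le_suminf summableI) auto
  finally show "(\<Sum>j<n. epowr (f j) a) \<le> epowr (\<Sum>j. f j) a" .
qed

text \<open>Clarkson's inequality for one exponent implies it for every larger one: the function \<open>x\<^sup>a\<close> is
  convex, so \<open>s\<^sup>a + t\<^sup>a \<ge> 2 ((s + t) / 2)\<^sup>a \<ge> 2 (u + v)\<^sup>a\<close>, and superadditive, so the last term is at least
  \<open>2 (u\<^sup>a + v\<^sup>a)\<close>.\<close>

lemma epowr_two_point:
  assumes a: "1 \<le> a" and uv: "2 * (u + v) \<le> s + t"
  shows "2 * (epowr u a + epowr v a) \<le> epowr s a + epowr t a"
proof (cases "s = top \<or> t = top")
  case True
  then show ?thesis by (auto simp: epowr_top)
next
  case False
  then obtain s' t' where s: "s = ennreal s'" "0 \<le> s'" and t: "t = ennreal t'" "0 \<le> t'"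
    by (metis ennreal_cases)
  have "u \<noteq> top" "v \<noteq> top" using uv False by (auto simp: ennreal_mult_top top_unique)
  then obtain u' v' where u: "u = ennreal u'" "0 \<le> u'" and v: "v = ennreal v'" "0 \<le> v'"
    by (metis ennreal_cases)
  have le: "u' + v' \<le> (s' + t') / 2"
  proof -
    have "ennreal (2 * (u' + v')) = 2 * ennreal (u' + v')"
      using u v ennreal_mult[of 2 "u' + v'"] by simp
    then have "ennreal (2 * (u' + v')) \<le> ennreal (s' + t')"
      using uv s t u v by simp
    then show ?thesis using s t by (simp add: ennreal_le_iff del: ennreal_plus)
  qed
  have "u' powr a + v' powr a \<le> (u' + v') powr a"
    using u v a by (intro powr_superadditive)
  also have "\<dots> \<le> ((s' + t') / 2) powr a"
    using le u v a by (intro powr_mono2) auto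
  also have "\<dots> \<le> (s' powr a + t' powr a) / 2"
    using powr_convex_nonneg[of s' t' "1/2" a] s t a by (simp add: add_divide_distrib)
  finally have "2 * (u' powr a + v' powr a) \<le> s' powr a + t' powr a" by simp
  then have "ennreal (2 * (u' powr a + v' powr a)) \<le> ennreal (s' powr a + t' powr a)"
    by (rule ennreal_leI)
  then show ?thesis using s t u v by (simp add: epowr_ennreal ennreal_mult)
qed

section \<open>Iterated sums\<close>

lemma iterated_sum_Cons:
  "qs \<noteq> [] \<Longrightarrow> iterated_sum (q # qs) f = (\<Sum>j. epowr (iterated_sum qs (\<lambda>js. f (j # js))) (q / hd qs))"
  by (cases qs) auto

lemma iterated_sum_cong:
  "(\<And>js. length js = length qs \<Longrightarrow> f js = g js) \<Longrightarrow> iterated_sum qs f = iterated_sum qs g"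
proof (induction qs f arbitrary: g rule: iterated_sum.induct)
  case (3 q q' qs f)
  have "iterated_sum (q' # qs) (\<lambda>js. f (j # js)) = iterated_sum (q' # qs) (\<lambda>js. g (j # js))" for j
    using 3 by simp
  then show ?case by simp
qed simp_all

text \<open>The innermost norm may be absorbed into the summand. With \<open>r\<close> as the innermost exponent this turns an
  iterated sum of \<open>\<ell>\<^sub>r\<close>-norms into an iterated sum of moduli of scalars, so that operators into \<open>\<ell>\<^sub>r\<close> and
  scalar forms become the same kind of object.\<close>

lemma iterated_sum_snoc:
  assumes "qs \<noteq> []" "0 < r"
  shows "iterated_sum (qs @ [r]) f
       = iterated_sum qs (\<lambda>js. epowr (\<Sum>i. epowr (f (js @ [i])) r) (1 / r))"
  using assms(1)
proof (induction qs arbitrary: f rule: list_nonempty_induct)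
  case (single q)
  then show ?case by (simp add: epowr_epowr)
next
  case (cons q qs)
  then show ?case by (simp add: iterated_sum_Cons)
qed

lemma iterated_sum_scale:
  assumes "qs \<noteq> []" "\<forall>q\<in>set qs. 0 < q" "0 \<le> t"
  shows "iterated_sum qs (\<lambda>js. ennreal t * f js) = ennreal (t powr hd qs) * iterated_sum qs f"
  using assms(1,2)
proof (induction qs arbitrary: f rule: list_nonempty_induct)
  case (single q)
  then show ?case using assms(3) by (simp add: epowr_mult_left ennreal_suminf_cmult)
next
  case (cons q qs)
  have "hd qs \<noteq> 0" using cons by (cases qs) auto
  with cons show ?case
    by (simp add: iterated_sum_Cons epowr_mult_left powr_powr)
qed

lemma iterated_norm_antimono:
  assumes "list_all2 (\<le>) qs qs'" "qs \<noteq> []" "\<forall>q\<in>set qs. 0 < q"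
  shows "epowr (iterated_sum qs' f) (1 / hd qs') \<le> epowr (iterated_sum qs f) (1 / hd qs)"
  using assms
proof (induction arbitrary: f rule: list_all2_induct)
  case (Cons q qs q' qs')
  have q: "0 < q" "q \<le> q'" using Cons by auto
  have outer: "epowr (\<Sum>j. epowr (g j) q') (1 / q') \<le> epowr (\<Sum>j. epowr (g j) q) (1 / q)"
    for g :: "nat \<Rightarrow> ennreal"
  proof -
    have "(\<Sum>j. epowr (g j) q') = (\<Sum>j. epowr (epowr (g j) q) (q' / q))"
      using q by (simp add: epowr_epowr)
    also have "\<dots> \<le> epowr (\<Sum>j. epowr (g j) q) (q' / q)"
      using q by (intro suminf_epowr_le) simp
    finally have "epowr (\<Sum>j. epowr (g j) q') (1 / q')
        \<le> epowr (epowr (\<Sum>j. epowr (g j) q) (q' / q)) (1 / q')"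
      using q by (intro epowr_mono) auto
    also have "\<dots> = epowr (\<Sum>j. epowr (g j) q) (1 / q)"
      using q by (simp add: epowr_epowr)
    finally show ?thesis .
  qed
  show ?case
  proof (cases "qs = []")
    case True
    then show ?thesis using Cons outer[of "\<lambda>j. f [j]"] by simp
  next
    case False
    then have ne: "qs' \<noteq> []" using Cons by auto
    have pos: "0 < hd qs" "0 < hd qs'"
      using Cons.hyps Cons.prems False ne by (cases qs; cases qs'; force)+
    have "(\<Sum>j. epowr (epowr (iterated_sum qs' (\<lambda>js. f (j # js))) (1 / hd qs')) q')
        \<le> (\<Sum>j. epowr (epowr (iterated_sum qs (\<lambda>js. f (j # js))) (1 / hd qs)) q')"
      using Cons False q by (intro suminf_le summableI epowr_mono) auto
    then have "epowr (iterated_sum (q' # qs') f) (1 / q')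
        \<le> epowr (\<Sum>j. epowr (epowr (iterated_sum qs (\<lambda>js. f (j # js))) (1 / hd qs)) q') (1 / q')"
      using q by (intro epowr_mono) (auto simp: iterated_sum_Cons[OF ne] epowr_epowr)
    also have "\<dots> \<le> epowr (\<Sum>j. epowr (epowr (iterated_sum qs (\<lambda>js. f (j # js))) (1 / hd qs)) q) (1 / q)"
      by (rule outer)
    also have "\<dots> = epowr (iterated_sum (q # qs) f) (1 / q)"
      by (simp add: iterated_sum_Cons[OF False] epowr_epowr)
    finally show ?thesis by simp
  qed
qed simp

text \<open>Mixed-norm spaces with exponents decreasing inwards and at least \<open>2\<close> satisfy Clarkson's inequality
  with constant \<open>1\<close>. It starts from the parallelogram law for scalars; every outer exponent is at least
  as large as the next inner one, so \<open>epowr_two_point\<close> passes the inequality outwards, and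
  summation preserves it.\<close>

lemma iterated_sum_clarkson:
  fixes G H :: "nat list \<Rightarrow> 'a::real_inner"
  assumes "qs \<noteq> []" "sorted_wrt (\<ge>) qs" "\<forall>q\<in>set qs. 2 \<le> q"
  shows "2 * (iterated_sum qs (\<lambda>js. norm (G js)) + iterated_sum qs (\<lambda>js. norm (H js)))
       \<le> iterated_sum qs (\<lambda>js. norm (G js + H js)) + iterated_sum qs (\<lambda>js. norm (G js - H js))"
  using assms
proof (induction qs arbitrary: G H rule: list_nonempty_induct)
  case (single q)
  have sq: "epowr (ennreal (norm x)) q = epowr (ennreal ((norm x)\<^sup>2)) (q / 2)" for x :: 'a
    by (simp add: epowr_ennreal powr_powr flip: powr_numeral)
  have "2 * (epowr (norm (G [j])) q + epowr (norm (H [j])) q)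
      \<le> epowr (norm (G [j] + H [j])) q + epowr (norm (G [j] - H [j])) q" for j
    unfolding sq
  proof (rule epowr_two_point)
    have "2 * ((norm (G [j]))\<^sup>2 + (norm (H [j]))\<^sup>2)
        = (norm (G [j] + H [j]))\<^sup>2 + (norm (G [j] - H [j]))\<^sup>2"
      by (simp add: power2_norm_eq_inner inner_simps inner_commute)
    then show "2 * (ennreal ((norm (G [j]))\<^sup>2) + ennreal ((norm (H [j]))\<^sup>2))
        \<le> ennreal ((norm (G [j] + H [j]))\<^sup>2) + ennreal ((norm (G [j] - H [j]))\<^sup>2)"
      by (metis ennreal_mult ennreal_numeral ennreal_plus order_refl zero_le_numeral zero_le_power2
          add_nonneg_nonneg)
  qed (use single in simp)
  then show ?case
    by (simp add: suminf_add summableI flip: ennreal_suminf_cmult) (intro suminf_le summableI)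
next
  case (cons q qs)
  have "hd qs \<in> set qs" using cons by simp
  then have "hd qs \<le> q" "2 \<le> hd qs" using cons.prems by auto
  then have ratio: "1 \<le> q / hd qs" by simp
  have "2 * (epowr (iterated_sum qs (\<lambda>js. norm (G (j # js)))) (q / hd qs)
           + epowr (iterated_sum qs (\<lambda>js. norm (H (j # js)))) (q / hd qs))
      \<le> epowr (iterated_sum qs (\<lambda>js. norm (G (j # js) + H (j # js)))) (q / hd qs)
        + epowr (iterated_sum qs (\<lambda>js. norm (G (j # js) - H (j # js)))) (q / hd qs)" for j
    using cons by (intro epowr_two_point ratio) auto
  then show ?case
    using cons(1)
    by (simp add: iterated_sum_Cons suminf_add summableI flip: ennreal_suminf_cmult)
       (intro suminf_le summableI)
qed

section \<open>Finitely supported sequences and scalar multiples\<close>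

lemma ell_finite_support:
  assumes "1 \<le> p" "\<forall>j\<ge>n. x j = 0"
  shows "x \<in> ell p"
proof (cases "p = \<infinity>")
  case True
  have "x \<longlonglongrightarrow> 0"
    by (rule tendsto_eventually[OF eventually_sequentiallyI[of n]]) (use assms in auto)
  with True show ?thesis by (simp add: ell_def)
next
  case False
  have "summable (\<lambda>j. norm (x j) powr real_of_ereal p)"
    by (rule summable_finite[of "{..<n}"]) (use assms in auto)
  with False show ?thesis by (simp add: ell_def)
qed

lemma ell_norm_finite_support_le_1:
  assumes "1 \<le> p" "\<forall>j\<ge>n. x j = 0" "\<And>j. norm (x j) \<le> 1"
    and "p \<noteq> \<infinity> \<Longrightarrow> (\<Sum>j<n. norm (x j) powr real_of_ereal p) \<le> 1"
  shows "ell_norm p x \<le> 1"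
proof (cases "p = \<infinity>")
  case True
  then show ?thesis using assms by (auto simp: ell_norm_def intro!: cSUP_least)
next
  case False
  then have "0 < real_of_ereal p" using assms(1) by (cases p) auto
  have eq: "(\<Sum>j. norm (x j) powr real_of_ereal p) = (\<Sum>j<n. norm (x j) powr real_of_ereal p)"
    by (rule suminf_finite) (use assms in auto)
  have "(\<Sum>j<n. norm (x j) powr real_of_ereal p) powr (1 / real_of_ereal p)
      \<le> 1 powr (1 / real_of_ereal p)"
    using assms(4)[OF False] \<open>0 < real_of_ereal p\<close> by (intro powr_mono2 sum_nonneg) auto
  then show ?thesis using False eq by (simp add: ell_norm_def)
qed

lemma unit_seq_in_ell: "1 \<le> p \<Longrightarrow> unit_seq j \<in> ell p"
  by (rule ell_finite_support[of _ "Suc j"]) (auto simp: unit_seq_def)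

lemma ell_norm_unit_seq_le: "1 \<le> p \<Longrightarrow> ell_norm p (unit_seq j :: nat \<Rightarrow> 'a::real_normed_field) \<le> 1"
proof (rule ell_norm_finite_support_le_1[of _ "Suc j"])
  have "(\<Sum>i<Suc j. norm (unit_seq j i :: 'a) powr real_of_ereal p)
      = (\<Sum>i<Suc j. if i = j then 1 else 0)"
    by (intro sum.cong) (auto simp: unit_seq_def)
  then show "(\<Sum>i<Suc j. norm (unit_seq j i :: 'a) powr real_of_ereal p) \<le> 1" by simp
qed (auto simp: unit_seq_def)

lemma seq_scale_in_ell: "x \<in> ell p \<Longrightarrow> seq_scale c x \<in> ell p"
  by (auto simp: ell_def seq_scale_def norm_mult powr_mult intro: tendsto_mult_right_zero summable_mult)

lemma ell_norm_seq_scale_le: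
  assumes "1 \<le> p" "x \<in> ell p"
  shows "ell_norm p (seq_scale c x) \<le> norm c * ell_norm p x"
proof (cases "p = \<infinity>")
  case True
  then show ?thesis using assms ell_PInf_le[of x]
    by (auto simp: ell_norm_def seq_scale_def norm_mult intro!: cSUP_least mult_left_mono)
next
  case False
  then obtain s where s: "p = ereal s" "1 \<le> s" using assms(1) by (cases p) auto
  have "summable (\<lambda>j. norm (x j) powr s)" using assms s by (simp add: ell_def)
  then show ?thesis using s
    by (simp add: ell_norm_def seq_scale_def norm_mult powr_mult suminf_mult suminf_nonneg powr_powr)
qed

lemma ell_norm_seq_scale:
  assumes "1 \<le> p" "x \<in> ell p"
  shows "ell_norm p (seq_scale c x) = norm c * ell_norm p x"
proof (rule antisym[OF ell_norm_seq_scale_le[OF assms]])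
  show "norm c * ell_norm p x \<le> ell_norm p (seq_scale c x)"
  proof (cases "c = 0")
    case True
    then show ?thesis using ell_norm_nonneg[OF seq_scale_in_ell[OF assms(2)]] by simp
  next
    case False
    then have "seq_scale (inverse c) (seq_scale c x) = x" by (simp add: seq_scale_def flip: mult.assoc)
    then have "ell_norm p x \<le> norm (inverse c) * ell_norm p (seq_scale c x)"
      using ell_norm_seq_scale_le[OF assms(1) seq_scale_in_ell[OF assms(2), of c], of "inverse c"] by simp
    then show ?thesis using False by (simp add: norm_divide field_simps)
  qed
qed

section \<open>Duality and the choice of signs\<close>

lemma recip_nonneg: "1 \<le> p \<Longrightarrow> 0 \<le> real_of_ereal (1 / p)"
  by (cases p) (auto simp: one_ereal_def)

text \<open>Equality case of Hoelder's inequality for the conjugate exponents \<open>a = 1 / (1 - d / p)\<close> and \<open>p / d\<close>. The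
  hypotheses say that \<open>\<Sum> b\<^sub>j\<^sup>d c\<^sub>j \<le> D\<close> for all nonnegative \<open>b\<close> of finite support in the unit ball of \<open>\<ell>\<^sub>p\<close>, where
  \<open>c\<^sub>j = L e\<^sub>j\<close>; the extremal choice \<open>b\<^sub>j = (c\<^sub>j\<^sup>a / \<Sum> c\<^sub>i\<^sup>a)\<^bsup>1/p\<^esup>\<close> gives \<open>\<Sum> c\<^sub>j\<^sup>a \<le> D\<^sup>a\<close>. The vector with moduli \<open>b\<^sub>j\<close> on
  which \<open>L\<close> is large is left to the user, because it is found in different ways in the two applications.\<close>

lemma holder_dual_bound:
  fixes L :: "(nat \<Rightarrow> 'a::real_normed_field) \<Rightarrow> ennreal"
  assumes p: "1 \<le> p" and d: "0 < d" "d * real_of_ereal (1 / p) < 1" and D: "0 \<le> D"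
    and bound: "\<And>x. x \<in> ell p \<Longrightarrow> ell_norm p x \<le> 1 \<Longrightarrow> L x \<le> ennreal D"
    and lower: "\<And>n b. (\<And>j. 0 \<le> b j) \<Longrightarrow> \<exists>x. (\<forall>j<n. norm (x j) = b j) \<and> (\<forall>j\<ge>n. x j = 0) \<and>
                  (\<Sum>j<n. ennreal (b j powr d) * L (unit_seq j)) \<le> L x"
  shows "(\<Sum>j. epowr (L (unit_seq j)) (1 / (1 - d * real_of_ereal (1 / p))))
           \<le> ennreal (D powr (1 / (1 - d * real_of_ereal (1 / p))))"
proof -
  define P where "P = real_of_ereal (1 / p)"
  define a where "a = 1 / (1 - d * P)"
  define c where "c j = enn2real (L (unit_seq j))" for j
  have P: "0 \<le> P" "d * P < 1" using p d recip_nonneg by (auto simp: P_def)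
  have a: "0 < a" "(1 - d * P) * a = 1" using P by (auto simp: a_def)
  \<comment> \<open>The power of \<open>c\<^sub>j\<close> in \<open>b\<^sub>j\<^sup>d c\<^sub>j\<close> for the extremal \<open>b\<close> is again \<open>a\<close>.\<close>
  have ae: "a * P * d + 1 = a" using P by (simp add: a_def field_simps)
  have c0: "0 \<le> c j" and Lc: "L (unit_seq j) = ennreal (c j)" for j
  proof -
    have "L (unit_seq j) \<le> ennreal D" using p
      by (intro bound unit_seq_in_ell ell_norm_unit_seq_le)
    then have "L (unit_seq j) < top" by (rule le_less_trans) simp
    then show "L (unit_seq j) = ennreal (c j)" by (simp add: c_def)
  qed (simp add: c_def)
  have "(\<Sum>j<n. epowr (L (unit_seq j)) a) \<le> ennreal (D powr a)" for n
  proof -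
    define T where "T = (\<Sum>j<n. c j powr a)"
    have eqT: "(\<Sum>j<n. epowr (L (unit_seq j)) a) = ennreal T"
      by (simp add: Lc epowr_ennreal c0 T_def sum_ennreal)
    have "T \<le> D powr a"
    proof (cases "T \<le> 0")
      case True
      then show ?thesis by (rule order_trans) simp
    next
      case False
      \<comment> \<open>For \<open>p = \<infinity>\<close> this is \<open>b\<^sub>j = 1\<close> where \<open>c\<^sub>j \<noteq> 0\<close>, and \<open>b\<^sub>j = 0\<close> elsewhere since \<open>0 powr 0 = 0\<close>.\<close>
      define b where "b j = (c j powr a / T) powr P" for j
      obtain x where x: "\<forall>j<n. norm (x j) = b j" "\<forall>j\<ge>n. x j = 0"
        and Lx: "(\<Sum>j<n. ennreal (b j powr d) * L (unit_seq j)) \<le> L x"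
        using lower[of b n] by (auto simp: b_def)
      have le1: "norm (x j) \<le> 1" for j
      proof (cases "j < n")
        case True
        then have "c j powr a \<le> T" unfolding T_def by (intro member_le_sum) auto
        then have "(c j powr a / T) powr P \<le> 1 powr P"
          using False P by (intro powr_mono2) auto
        then show ?thesis using x True by (simp add: b_def)
      qed (use x in simp)
      have sum1: "(\<Sum>j<n. norm (x j) powr real_of_ereal p) \<le> 1" if "p \<noteq> \<infinity>"
      proof -
        have "P * real_of_ereal p = 1" using that p unfolding P_def by (cases p) (auto simp: one_ereal_def)
        then have "norm (x j) powr real_of_ereal p = c j powr a / T" if "j < n" for j
          using x that False by (simp add: b_def powr_powr)
        then have "(\<Sum>j<n. norm (x j) powr real_of_ereal p) = (\<Sum>j<n. c j powr a / T)" by simp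
        also have "\<dots> = 1" using False by (simp add: T_def flip: sum_divide_distrib)
        finally show ?thesis by simp
      qed
      have "L x \<le> ennreal D"
        by (intro bound ell_finite_support[OF p x(2)] ell_norm_finite_support_le_1[OF p x(2) le1 sum1])
      with Lx have le: "(\<Sum>j<n. ennreal (b j powr d) * L (unit_seq j)) \<le> ennreal D"
        by (rule order_trans)
      have summand: "b j powr d * c j = c j powr a / T powr (P * d)" for j
      proof (cases "c j = 0")
        case False
        have "c j powr (a * P * d) * c j = c j powr (a * P * d + 1)"
          using c0[of j] False by (simp add: powr_add)
        then have eq: "c j powr (a * P * d) * c j = c j powr a" by (simp only: ae)
        have "b j powr d = c j powr (a * P * d) / T powr (P * d)"
          using c0[of j] \<open>\<not> T \<le> 0\<close> by (simp add: b_def powr_powr powr_divide mult.assoc)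
        then show ?thesis by (simp add: eq)
      qed simp
      have "(\<Sum>j<n. ennreal (b j powr d) * L (unit_seq j)) = ennreal (\<Sum>j<n. b j powr d * c j)"
        by (simp add: Lc c0 sum_ennreal flip: ennreal_mult)
      also have "(\<Sum>j<n. b j powr d * c j) = T / T powr (P * d)"
        by (simp add: summand T_def sum_divide_distrib)
      also have "\<dots> = T powr (1 - d * P)"
        using False by (simp add: powr_diff mult.commute)
      finally have "T powr (1 - d * P) \<le> D" using le D by (simp add: ennreal_le_iff)
      then have "(T powr (1 - d * P)) powr a \<le> D powr a" using a by (intro powr_mono2) auto
      then show ?thesis using a False by (simp add: powr_powr)
    qed
    then show ?thesis unfolding eqT by (rule ennreal_leI)
  qed
  then show ?thesis unfolding P_def[symmetric] a_def[symmetric]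
    by (intro suminf_le_const[OF summableI])
qed

text \<open>This replaces the usual average over random signs. If \<open>x\<close> and \<open>y\<close> are given, then by Clarkson's inequality
  one of \<open>x + y\<close> and \<open>x - y\<close> has functional at least the sum of those of \<open>x\<close> and \<open>y\<close>; adding the vectors
  \<open>b\<^sub>j e\<^sub>j\<close> one after the other, each with the better sign, loses nothing.\<close>

lemma greedy_signs:
  fixes G :: "(nat \<Rightarrow> 'a::{real_normed_field,real_inner}) \<Rightarrow> nat list \<Rightarrow> 'a"
  assumes qs: "qs \<noteq> []" "sorted_wrt (\<ge>) qs" "\<forall>q\<in>set qs. 2 \<le> q" and p: "1 \<le> p"
    and add: "\<And>u v js. u \<in> ell p \<Longrightarrow> v \<in> ell p \<Longrightarrow> G (u + v) js = G u js + G v js"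
    and scale: "\<And>u c js. u \<in> ell p \<Longrightarrow> G (seq_scale c u) js = c * G u js"
    and b: "\<And>j. 0 \<le> b j"
  shows "\<exists>x. (\<forall>j<n. norm (x j) = b j) \<and> (\<forall>j\<ge>n. x j = 0) \<and>
           (\<Sum>j<n. ennreal (b j powr hd qs) * iterated_sum qs (\<lambda>js. norm (G (unit_seq j) js)))
             \<le> iterated_sum qs (\<lambda>js. norm (G x js))"
proof (induction n)
  case 0
  show ?case by (intro exI[of _ 0]) simp
next
  case (Suc n)
  define I where "I x = iterated_sum qs (\<lambda>js. norm (G x js))" for x
  from Suc obtain x where x: "\<forall>j<n. norm (x j) = b j" "\<forall>j\<ge>n. x j = 0"
    and Ix: "(\<Sum>j<n. ennreal (b j powr hd qs) * I (unit_seq j)) \<le> I x"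
    unfolding I_def by blast
  define y :: "nat \<Rightarrow> 'a" where "y = seq_scale (of_real (b n)) (unit_seq n)"
  have xin: "x \<in> ell p" using ell_finite_support[OF p x(2)] .
  have yin: "y \<in> ell p" unfolding y_def by (intro seq_scale_in_ell unit_seq_in_ell p)
  have pos: "\<forall>q\<in>set qs. 0 < q" using qs(3) by force
  have Iy: "I y = ennreal (b n powr hd qs) * I (unit_seq n)"
    unfolding I_def y_def
    using iterated_sum_scale[OF qs(1) pos b[of n]] b[of n]
    by (simp add: scale unit_seq_in_ell[OF p] norm_mult ennreal_mult)
  have yin': "seq_scale (-1) y \<in> ell p" using yin by (rule seq_scale_in_ell)
  have "2 * (I x + I y) \<le> I (x + y) + I (x + seq_scale (-1) y)"
    using iterated_sum_clarkson[OF qs, of "G x" "G y"]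
    by (simp add: I_def add scale xin yin yin')
  then have "I x + I y \<le> I (x + y) \<or> I x + I y \<le> I (x + seq_scale (-1) y)"
    by (metis add_strict_mono leD mult_2 not_le)
  then obtain z where z: "z = x + y \<or> z = x + seq_scale (-1) y" and Iz: "I x + I y \<le> I z"
    by blast
  have "\<forall>j<Suc n. norm (z j) = b j" "\<forall>j\<ge>Suc n. z j = 0"
    using z x b[of n] by (auto simp: y_def seq_scale_def unit_seq_def less_Suc_eq)
  moreover have "(\<Sum>j<Suc n. ennreal (b j powr hd qs) * I (unit_seq j)) \<le> I z"
    using Ix Iy Iz by (auto intro: order_trans add_right_mono)
  ultimately show ?case unfolding I_def by blast
qed

section \<open>The inequality with the critical exponents\<close>

text \<open>The exponents are determined by \<open>1 / crit_exponent r [p\<^sub>k, \<dots>, p\<^sub>m] = 1 / r - 1 / p\<^sub>k - \<dots> - 1 / p\<^sub>m\<close>. The list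
  \<open>crit_exponents\<close> ends with \<open>r\<close> itself, the exponent of the target space.\<close>

definition crit_exponent :: "real \<Rightarrow> ereal list \<Rightarrow> real" where
  "crit_exponent r ps = r / (1 - (\<Sum>p\<leftarrow>ps. real_of_ereal (1 / p)) * r)"

fun crit_exponents :: "real \<Rightarrow> ereal list \<Rightarrow> real list" where
  "crit_exponents r [] = [r]"
| "crit_exponents r (p # ps) = crit_exponent r (p # ps) # crit_exponents r ps"

lemma crit_exponents_ne: "crit_exponents r ps \<noteq> []"
  by (cases ps) auto

lemma hd_crit_exponents: "hd (crit_exponents r ps) = crit_exponent r ps"
  by (cases ps) (auto simp: crit_exponent_def)

text \<open>Adding \<open>p\<close> in front is exactly one application of \<open>holder_dual_bound\<close> to a functional of degree \<open>d\<close>: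
  the new exponent divided by the old one is the exponent that this lemma produces.\<close>

lemma crit_exponent_Cons:
  assumes "2 \<le> r" "1 \<le> p" "(\<Sum>p\<leftarrow>p # ps. real_of_ereal (1 / p)) * r < 1"
  defines "d \<equiv> crit_exponent r ps"
  shows "0 < d" "d * real_of_ereal (1 / p) < 1" 
    "crit_exponent r (p # ps) / d = 1 / (1 - d * real_of_ereal (1 / p))" "d \<le> crit_exponent r (p # ps)"
proof -
  define P where "P = real_of_ereal (1 / p)"
  define S where "S = (\<Sum>p\<leftarrow>ps. real_of_ereal (1 / p))"
  have P: "0 \<le> P * r" using recip_nonneg[OF assms(2)] assms(1) by (simp add: P_def)
  have lt: "P * r + S * r < 1" using assms(3) by (simp add: P_def S_def distrib_right)
  have d: "d = r / (1 - S * r)" by (simp add: d_def crit_exponent_def S_def)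
  have d': "crit_exponent r (p # ps) = r / (1 - (P * r + S * r))"
    by (simp add: crit_exponent_def S_def P_def distrib_right)
  have pos: "0 < 1 - S * r" "0 < 1 - (P * r + S * r)" using P lt by auto
  show "0 < d" using pos assms(1) by (simp add: d)
  show "d * real_of_ereal (1 / p) < 1"
    unfolding d P_def[symmetric] using pos lt by (simp add: field_simps)
  have "1 - d * P = (1 - (P * r + S * r)) / (1 - S * r)"
    unfolding d using pos by (simp add: field_simps)
  then show "crit_exponent r (p # ps) / d = 1 / (1 - d * real_of_ereal (1 / p))"
    unfolding P_def[symmetric] d' using pos assms(1) by (simp add: d)
  show "d \<le> crit_exponent r (p # ps)"
    unfolding d d' using pos P assms(1) by (intro divide_left_mono) auto
qed

lemma crit_exponents_sorted:
  assumes "2 \<le> r" "\<forall>p\<in>set ps. 1 \<le> p" "(\<Sum>p\<leftarrow>ps. real_of_ereal (1 / p)) * r < 1"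
  shows "sorted_wrt (\<ge>) (crit_exponents r ps) \<and> (\<forall>q\<in>set (crit_exponents r ps). r \<le> q \<and> q \<le> crit_exponent r ps)"
  using assms
proof (induction ps)
  case (Cons p ps)
  have "0 \<le> real_of_ereal (1 / p) * r"
    using recip_nonneg[of p] Cons.prems by simp
  then have lt: "(\<Sum>p\<leftarrow>ps. real_of_ereal (1 / p)) * r < 1"
    using Cons.prems by (simp add: distrib_right)
  have IH: "sorted_wrt (\<ge>) (crit_exponents r ps)"
    "\<And>q. q \<in> set (crit_exponents r ps) \<Longrightarrow> r \<le> q \<and> q \<le> crit_exponent r ps"
    using Cons.IH[OF Cons.prems(1) _ lt] Cons.prems(2) by auto
  have mono: "crit_exponent r ps \<le> crit_exponent r (p # ps)"
    using Cons.prems by (intro crit_exponent_Cons) auto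
  have "r \<le> crit_exponent r ps"
    using IH(2)[OF hd_in_set[OF crit_exponents_ne]] by (simp add: hd_crit_exponents)
  with mono IH show ?case by (auto intro: order_trans)
qed (simp add: crit_exponent_def)

text \<open>Arguments are lists, so that fixing the first one leaves an object of the same kind and induction on
  the number of arguments is possible. The values are families of scalars, indexed by the type \<open>'c\<close>.\<close>

definition multilinear_on ::
  "ereal list \<Rightarrow> ((nat \<Rightarrow> 'a::real_normed_field) list \<Rightarrow> 'c \<Rightarrow> 'a) \<Rightarrow> bool" where
  "multilinear_on ps B \<longleftrightarrow> (\<forall>xs i. list_all2 (\<lambda>x p. x \<in> ell p) xs ps \<longrightarrow> i < length ps \<longrightarrow>
     (\<forall>u\<in>ell (ps ! i). \<forall>v\<in>ell (ps ! i). \<forall>c t.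
        B (xs[i := u + v]) t = B (xs[i := u]) t + B (xs[i := v]) t \<and>
        B (xs[i := seq_scale c u]) t = c * B (xs[i := u]) t))"

lemma multilinear_on_Cons:
  fixes B :: "(nat \<Rightarrow> 'a::real_normed_field) list \<Rightarrow> 'c \<Rightarrow> 'a"
  assumes "multilinear_on (p # ps) B" "x \<in> ell p"
  shows "multilinear_on ps (\<lambda>xs. B (x # xs))"
  unfolding multilinear_on_def
proof (intro allI impI ballI)
  fix xs :: "(nat \<Rightarrow> 'a) list" and i :: nat and u v :: "nat \<Rightarrow> 'a" and c t
  assume "list_all2 (\<lambda>x p. x \<in> ell p) xs ps" "i < length ps" "u \<in> ell (ps ! i)" "v \<in> ell (ps ! i)"
  with assms(1)[unfolded multilinear_on_def, rule_format, of "x # xs" "Suc i" u v t c] assms(2)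
  show "B (x # xs[i := u + v]) t = B (x # xs[i := u]) t + B (x # xs[i := v]) t \<and>
      B (x # xs[i := seq_scale c u]) t = c * B (x # xs[i := u]) t" by simp
qed

lemma multilinear_on_hd:
  assumes "multilinear_on (p # ps) B" "list_all2 (\<lambda>x p. x \<in> ell p) xs ps" "u \<in> ell p"
  shows "v \<in> ell p \<Longrightarrow> B ((u + v) # xs) t = B (u # xs) t + B (v # xs) t"
    "B (seq_scale c u # xs) t = c * B (u # xs) t"
  using assms(1)[unfolded multilinear_on_def, rule_format, of "u # xs" 0 u v t c]
    assms(1)[unfolded multilinear_on_def, rule_format, of "u # xs" 0 u u t c] assms(2,3) by auto

text \<open>Written with \<open>js ! i\<close> instead of \<open>take n js\<close>, the result has length \<open>n\<close> for every \<open>js\<close>; thus multilinearity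
  can be used without knowing the length of the index list.\<close>

definition unit_seqs :: "nat \<Rightarrow> nat list \<Rightarrow> (nat \<Rightarrow> 'a::real_normed_field) list" where
  "unit_seqs n js = map (\<lambda>i. unit_seq (js ! i)) [0..<n]"

lemma unit_seqs_Cons: "unit_seqs (Suc n) (j # js) = unit_seq j # unit_seqs n js"
  unfolding unit_seqs_def by (subst map_upt_Suc) simp

text \<open>Induction on the number of arguments. For fixed \<open>x\<close> in the unit ball the induction hypothesis bounds the
  mixed norm of \<open>B (x # e\<^sub>j\<^sub>s)\<close>, where \<open>e\<^sub>j\<^sub>s\<close> runs over the tuples of unit vectors. This norm, raised to its
  outermost exponent \<open>d\<close>, is a functional of \<open>x\<close> of degree \<open>d\<close> on which \<open>greedy_signs\<close> can be used because the
  critical exponents decrease inwards; duality with \<open>\<ell>\<^sub>p\<close> then gives the sum over the first index.\<close>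

lemma multilinear_bound:
  fixes B :: "(nat \<Rightarrow> 'a::{real_normed_field,real_inner}) list \<Rightarrow> nat list \<Rightarrow> 'a"
  assumes "2 \<le> r" "\<forall>p\<in>set ps. 1 \<le> p" "(\<Sum>p\<leftarrow>ps. real_of_ereal (1 / p)) * r < 1" "0 \<le> M"
    and "multilinear_on ps B"
    and "\<And>xs. list_all2 (\<lambda>x p. x \<in> ell p \<and> ell_norm p x \<le> 1) xs ps \<Longrightarrow>
           (\<Sum>j. epowr (norm (B xs [j])) r) \<le> ennreal (M powr r)"
  shows "iterated_sum (crit_exponents r ps)
           (\<lambda>js. norm (B (unit_seqs (length ps) js) (drop (length ps) js)))
         \<le> ennreal (M powr crit_exponent r ps)"
  using assms(2-)
proof (induction ps arbitrary: B)
  case Nil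
  then show ?case by (simp add: unit_seqs_def crit_exponent_def)
next
  case (Cons p ps)
  define qs where "qs = crit_exponents r ps"
  define d where "d = crit_exponent r ps"
  define G where "G x js = B (x # unit_seqs (length ps) js) (drop (length ps) js)" for x js
  have p: "1 \<le> p" and ps: "\<forall>p\<in>set ps. 1 \<le> p" using Cons.prems by auto
  have "0 \<le> real_of_ereal (1 / p) * r" using recip_nonneg[OF p] assms(1) by simp
  then have lt: "(\<Sum>p\<leftarrow>ps. real_of_ereal (1 / p)) * r < 1"
    using Cons.prems(2) by (simp add: distrib_right)
  note crit = crit_exponent_Cons[OF assms(1) p Cons.prems(2), folded d_def]
  have qs: "qs \<noteq> []" "sorted_wrt (\<ge>) qs" "\<forall>q\<in>set qs. 2 \<le> q"
    using crit_exponents_sorted[OF assms(1) ps lt] assms(1) crit_exponents_ne by (auto simp: qs_def)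
  have hd_qs: "hd qs = d" by (simp add: qs_def d_def hd_crit_exponents)
  have units: "list_all2 (\<lambda>x p. x \<in> ell p) (unit_seqs (length ps) js :: (nat \<Rightarrow> 'a) list) ps" for js
    using ps by (auto simp: list_all2_conv_all_nth unit_seqs_def intro!: unit_seq_in_ell)
  have "(\<Sum>j. epowr (iterated_sum qs (\<lambda>js. norm (G (unit_seq j) js))) (1 / (1 - d * real_of_ereal (1 / p))))
      \<le> ennreal ((M powr d) powr (1 / (1 - d * real_of_ereal (1 / p))))"
  proof (rule holder_dual_bound[where L = "\<lambda>x. iterated_sum qs (\<lambda>js. norm (G x js))", OF p crit(1,2)])
    fix x :: "nat \<Rightarrow> 'a" assume "x \<in> ell p" "ell_norm p x \<le> 1"
    then show "iterated_sum qs (\<lambda>js. norm (G x js)) \<le> ennreal (M powr d)"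
      unfolding qs_def d_def G_def
      using Cons.prems(5)[of "x # xs" for xs]
      by (intro Cons.IH ps lt Cons.prems(3) multilinear_on_Cons[OF Cons.prems(4)]) auto
  next
    fix n and b :: "nat \<Rightarrow> real" assume "\<And>j. 0 \<le> b j"
    then show "\<exists>x. (\<forall>j<n. norm (x j) = b j) \<and> (\<forall>j\<ge>n. x j = 0) \<and>
        (\<Sum>j<n. ennreal (b j powr d) * iterated_sum qs (\<lambda>js. norm (G (unit_seq j) js)))
          \<le> iterated_sum qs (\<lambda>js. norm (G x js))"
      unfolding hd_qs[symmetric] G_def
      by (intro greedy_signs[OF qs p] multilinear_on_hd[OF Cons.prems(4) units])
  qed simp
  then show ?case
    using crit(1) unfolding crit(3)[symmetric]
    by (simp add: iterated_sum_Cons[OF qs(1)] hd_qs unit_seqs_Cons powr_powr G_def flip: qs_def)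
qed

section \<open>Larger exponents\<close>

lemma iterated_norm_le_of_crit:
  assumes "2 \<le> r" "\<forall>p\<in>set ps. 1 \<le> p" "(\<Sum>p\<leftarrow>ps. real_of_ereal (1 / p)) * r < 1" "0 \<le> M"
    and f: "iterated_sum (crit_exponents r ps) f \<le> ennreal (M powr crit_exponent r ps)"
    and qs: "length qs = Suc (length ps)" "\<And>i. i \<le> length ps \<Longrightarrow> crit_exponent r (drop i ps) \<le> qs ! i"
  shows "epowr (iterated_sum qs f) (1 / hd qs) \<le> ennreal M"
proof -
  have dominate: "list_all2 (\<le>) (crit_exponents r ps') qs'"
    if "length qs' = Suc (length ps')" "\<And>i. i \<le> length ps' \<Longrightarrow> crit_exponent r (drop i ps') \<le> qs' ! i"
    for ps' qs'
    using that
  proof (induction ps' arbitrary: qs')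
    case Nil
    then show ?case by (cases qs') (auto simp: crit_exponent_def)
  next
    case (Cons p ps')
    then obtain q qs'' where q: "qs' = q # qs''" by (cases qs') auto
    have "crit_exponent r (drop i ps') \<le> qs'' ! i" if "i \<le> length ps'" for i
      using Cons.prems(2)[of "Suc i"] that q by simp
    then show ?case using Cons.IH[of qs''] Cons.prems(1) Cons.prems(2)[of 0] q by simp
  qed
  have ge: "\<forall>q\<in>set (crit_exponents r ps). r \<le> q"
    using crit_exponents_sorted[OF assms(1-3)] by blast
  then have pos: "\<forall>q\<in>set (crit_exponents r ps). 0 < q" using assms(1) by force
  then have c: "0 < crit_exponent r ps"
    using hd_in_set[OF crit_exponents_ne] by (metis hd_crit_exponents)
  have "epowr (iterated_sum qs f) (1 / hd qs)
      \<le> epowr (iterated_sum (crit_exponents r ps) f) (1 / hd (crit_exponents r ps))"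
    by (intro iterated_norm_antimono dominate qs crit_exponents_ne pos)
  also have "\<dots> \<le> epowr (ennreal (M powr crit_exponent r ps)) (1 / crit_exponent r ps)"
    unfolding hd_crit_exponents using c by (intro epowr_mono f) auto
  also have "\<dots> = ennreal M" using c assms(4) by (simp add: epowr_ennreal powr_powr)
  finally show ?thesis .
qed

section \<open>Linear functionals\<close>

lemma finite_support_expansion:
  fixes G :: "(nat \<Rightarrow> 'a::real_normed_field) \<Rightarrow> 'a"
  assumes p: "1 \<le> p"
    and add: "\<And>u v. u \<in> ell p \<Longrightarrow> v \<in> ell p \<Longrightarrow> G (u + v) = G u + G v"
    and scale: "\<And>u c. u \<in> ell p \<Longrightarrow> G (seq_scale c u) = c * G u"
    and "\<forall>j\<ge>n. x j = 0"
  shows "G x = (\<Sum>j<n. x j * G (unit_seq j))"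
  using assms(4)
proof (induction n arbitrary: x)
  case 0
  then have "x = seq_scale 0 x" by (auto simp: seq_scale_def)
  moreover have "x \<in> ell p" using ell_finite_support[OF p 0] .
  ultimately show ?case using scale[of x 0] by simp
next
  case (Suc n)
  define y where "y = x(n := 0)"
  have y: "\<forall>j\<ge>n. y j = 0" using Suc.prems by (auto simp: y_def Suc_le_eq)
  have "x = y + seq_scale (x n) (unit_seq n)"
    by (auto simp: y_def seq_scale_def unit_seq_def fun_eq_iff)
  then have "G x = G (y + seq_scale (x n) (unit_seq n))" by simp
  also have "\<dots> = G y + x n * G (unit_seq n)"
    by (simp add: add scale ell_finite_support[OF p y] seq_scale_in_ell unit_seq_in_ell[OF p])
  also have "G y = (\<Sum>j<n. x j * G (unit_seq j))"
    unfolding Suc.IH[OF y] by (intro sum.cong) (auto simp: y_def)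
  finally show ?case by simp
qed

text \<open>The dual of \<open>\<ell>\<^sub>p\<close> embeds into \<open>\<ell>\<^sub>q\<close> for the conjugate exponent \<open>q\<close>. Here the functional \<open>\<bar>G x\<bar>\<close> has degree \<open>1\<close>,
  for which Clarkson's inequality fails, but the unimodular factors can be chosen to align all terms.\<close>

lemma functional_coefficients:
  fixes G :: "(nat \<Rightarrow> 'a::real_normed_field) \<Rightarrow> 'a"
  assumes p: "1 \<le> p" "real_of_ereal (1 / p) < 1"
    and add: "\<And>u v. u \<in> ell p \<Longrightarrow> v \<in> ell p \<Longrightarrow> G (u + v) = G u + G v"
    and scale: "\<And>u c. u \<in> ell p \<Longrightarrow> G (seq_scale c u) = c * G u"
    and D: "0 \<le> D" and bound: "\<And>x. x \<in> ell p \<Longrightarrow> ell_norm p x \<le> 1 \<Longrightarrow> norm (G x) \<le> D"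
  shows "(\<Sum>j. epowr (norm (G (unit_seq j))) (1 / (1 - real_of_ereal (1 / p))))
           \<le> ennreal (D powr (1 / (1 - real_of_ereal (1 / p))))"
proof -
  have "\<exists>x. (\<forall>j<n. norm (x j) = b j) \<and> (\<forall>j\<ge>n. x j = 0) \<and>
      (\<Sum>j<n. ennreal (b j powr 1) * ennreal (norm (G (unit_seq j)))) \<le> ennreal (norm (G x))"
    if b: "\<And>j. 0 \<le> b j" for n and b :: "nat \<Rightarrow> real"
  proof -
    define a where "a j = G (unit_seq j)" for j
    define x where "x j = (if j < n then of_real (b j) * (if a j = 0 then 1 else of_real (norm (a j)) / a j) else 0)" for j
    have x: "\<forall>j\<ge>n. x j = 0" "\<forall>j<n. norm (x j) = b j"
      using b by (auto simp: x_def norm_mult norm_divide)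
    have "G x = (\<Sum>j<n. x j * a j)"
      unfolding a_def by (rule finite_support_expansion[OF p(1) add scale x(1)])
    also have "\<dots> = of_real (\<Sum>j<n. b j * norm (a j))"
      unfolding of_real_sum by (intro sum.cong) (auto simp: x_def)
    finally have Gx: "G x = of_real (\<Sum>j<n. b j * norm (a j))" .
    have "norm (G x) = (\<Sum>j<n. b j * norm (a j))"
      unfolding Gx norm_of_real using b by (simp add: sum_nonneg)
    also have "ennreal \<dots> = (\<Sum>j<n. ennreal (b j powr 1) * ennreal (norm (a j)))"
      using b by (simp add: ennreal_mult flip: sum_ennreal)
    finally show ?thesis using x unfolding a_def by auto
  qed
  then show ?thesis
    using holder_dual_bound[of p 1 D "\<lambda>x. ennreal (norm (G x))"] p D bound by (simp add: ennreal_leI)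
qed

section \<open>Boundedness of continuous multilinear maps\<close>

lemma topspace_ell_topology: "1 \<le> p \<Longrightarrow> topspace (ell_topology p) = ell p"
  unfolding ell_topology_def by (rule Metric_space.topspace_mtopology[OF Metric_space_ell])

lemma continuous_multilinear_range:
  assumes "continuous_multilinear m p T scl A" "\<forall>k\<in>{1..m}. 1 \<le> p k" "x \<in> PiE {1..m} (\<lambda>k. ell (p k))"
  shows "A x \<in> topspace T"
proof -
  have "x \<in> topspace (product_topology (\<lambda>k. ell_topology (p k)) {1..m})"
    using assms(2,3) by (auto simp: topspace_ell_topology PiE_iff)
  then show ?thesis using assms(1)
    by (auto simp: continuous_multilinear_def continuous_map_def)
qed

text \<open>The real supremum in \<open>multilinear_norm\<close> is only meaningful if it is taken over a bounded set, so
  this needs that continuity at the origin implies boundedness on the product of unit balls: the image of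
  a small polyball lies in the unit ball of the target, and the radii can be scaled out one argument
  at a time.\<close>

lemma multilinear_norm_upper:
  fixes A :: "(nat \<Rightarrow> nat \<Rightarrow> 'a::real_normed_field) \<Rightarrow> 'b::plus"
  assumes A: "continuous_multilinear m p T scl A" and m: "1 \<le> m" and p: "\<forall>k\<in>{1..m}. 1 \<le> p k"
    and hom: "\<And>c y. y \<in> topspace T \<Longrightarrow> N (scl c y) = norm c * N y"
    and unit_ball: "openin T {y \<in> topspace T. N y < 1}"
    and x: "x \<in> PiE {1..m} (\<lambda>k. {u \<in> ell (p k). ell_norm (p k) u \<le> 1})"
  shows "N (A x) \<le> multilinear_norm m p N A"
proof -
  let ?X = "PiE {1..m} (\<lambda>k. ell (p k) :: (nat \<Rightarrow> 'a) set)"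
  have scale: "A (x(k := seq_scale c u)) = scl c (A (x(k := u)))"
    if "x \<in> ?X" "k \<in> {1..m}" "u \<in> ell (p k)" for x k u c
    using A that by (auto simp: continuous_multilinear_def)
  have range: "A x \<in> topspace T" if "x \<in> ?X" for x
    using continuous_multilinear_range[OF A p that] .
  have dilate: "N (A (\<lambda>k\<in>{1..m}. if k \<in> S then seq_scale (t k) (x k) else x k))
      = (\<Prod>k\<in>S. norm (t k)) * N (A x)" 
    if x: "x \<in> ?X" and "finite S" and "S \<subseteq> {1..m}" for x t S
    using that(2,3)
  proof (induction S)
    case empty
    have "(\<lambda>k\<in>{1..m}. x k) = x" using x by (rule PiE_restrict)
    then show ?case by simp
  next
    case (insert k S)
    define y where "y = (\<lambda>k\<in>{1..m}. if k \<in> S then seq_scale (t k) (x k) else x k)"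
    have y: "y \<in> ?X" using x by (auto simp: y_def PiE_iff intro: seq_scale_in_ell)
    have yk: "y k = x k" "x k \<in> ell (p k)" "k \<in> {1..m}" using insert x by (auto simp: y_def PiE_iff)
    have "(\<lambda>i\<in>{1..m}. if i \<in> insert k S then seq_scale (t i) (x i) else x i) = y(k := seq_scale (t k) (x k))"
      using insert by (auto simp: y_def fun_eq_iff)
    then have "A (\<lambda>i\<in>{1..m}. if i \<in> insert k S then seq_scale (t i) (x i) else x i) = scl (t k) (A y)"
      using scale[OF y yk(3,2)] yk(1) by (metis fun_upd_triv)
    then have step: "N (A (\<lambda>i\<in>{1..m}. if i \<in> insert k S then seq_scale (t i) (x i) else x i))
        = norm (t k) * N (A y)"
      using hom[OF range[OF y]] by metis
    have IH: "N (A y) = (\<Prod>k\<in>S. norm (t k)) * N (A x)"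
      unfolding y_def by (rule insert.IH) (use insert.prems in auto)
    show ?case unfolding step IH using insert.hyps by simp
  qed
  define x0 :: "nat \<Rightarrow> nat \<Rightarrow> 'a" where "x0 = (\<lambda>k\<in>{1..m}. 0)"
  have zero_in_ell: "(0 :: nat \<Rightarrow> 'a) \<in> ell (p k)" if "k \<in> {1..m}" for k
    using p that by (intro ell_finite_support[of _ 0]) auto
  have x0: "x0 \<in> ?X" using zero_in_ell by (auto simp: x0_def PiE_iff)
  have "x0(1 := seq_scale 0 0) = x0" "x0(1 := 0) = x0"
    using m by (auto simp: x0_def seq_scale_def fun_eq_iff)
  moreover have "A (x0(1 := seq_scale 0 0)) = scl 0 (A (x0(1 := 0)))"
    using scale[OF x0, of 1 0 0] zero_in_ell m by simp
  ultimately have "A x0 = scl 0 (A x0)" by simp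
  then have N0: "N (A x0) = 0" using hom[OF range[OF x0], of 0] by simp
  let ?P = "product_topology (\<lambda>k. ell_topology (p k) :: (nat \<Rightarrow> 'a) topology) {1..m}"
  have tsP: "topspace ?P = ?X" using p by (auto simp: topspace_ell_topology intro!: PiE_cong)
  define U where "U = {x \<in> topspace ?P. A x \<in> {y \<in> topspace T. N y < 1}}"
  have "openin ?P U"
    unfolding U_def using A unit_ball unfolding continuous_multilinear_def
    by (intro openin_continuous_map_preimage) auto
  moreover have "x0 \<in> U"
    unfolding U_def tsP using x0 range[OF x0] N0 by simp
  ultimately obtain W where W: "\<forall>k\<in>{1..m}. openin (ell_topology (p k)) (W k)" "x0 \<in> PiE {1..m} W"
    and WU: "PiE {1..m} W \<subseteq> U"
    unfolding openin_product_topology_alt by metis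
  have "\<exists>e>0. \<forall>u\<in>ell (p k). ell_norm (p k) u < e \<longrightarrow> u \<in> W k" if k: "k \<in> {1..m}" for k
  proof -
    interpret Metric_space "ell (p k) :: (nat \<Rightarrow> 'a) set" "\<lambda>x y. \<bar>ell_norm (p k) (x - y)\<bar>"
      by (rule Metric_space_ell) (use p k in auto)
    have "openin mtopology (W k)" "0 \<in> W k"
      using W k by (auto simp: ell_topology_def x0_def PiE_iff)
    then obtain e where e: "0 < e" "mball 0 e \<subseteq> W k" by (auto simp: openin_mtopology)
    have "u \<in> W k" if "u \<in> ell (p k)" "ell_norm (p k) u < e" for u
      using that e zero_in_ell[OF k] ell_norm_nonneg[of u "p k"] ell_norm_minus[of "p k" u]
      by (auto simp: subset_iff)
    with e(1) show ?thesis by blast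
  qed
  then obtain e where e: "\<And>k. k \<in> {1..m} \<Longrightarrow> 0 < e k"
    and eW: "\<And>k u. k \<in> {1..m} \<Longrightarrow> u \<in> ell (p k) \<Longrightarrow> ell_norm (p k) u < e k \<Longrightarrow> u \<in> W k"
    by metis
  define t where "t = (\<Prod>k\<in>{1..m}. e k / 2)"
  have t: "0 < t" unfolding t_def using e by (intro prod_pos) auto
  have bound: "N (A x) \<le> 1 / t" if x: "x \<in> PiE {1..m} (\<lambda>k. {u \<in> ell (p k). ell_norm (p k) u \<le> 1})" for x
  proof -
    have xX: "x \<in> ?X" using x by (auto simp: PiE_iff)
    define z where "z = (\<lambda>k\<in>{1..m}. if k \<in> {1..m} then seq_scale (of_real (e k / 2)) (x k) else x k)"
    have "z k \<in> W k" if k: "k \<in> {1..m}" for k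
    proof -
      have xk: "x k \<in> ell (p k)" "ell_norm (p k) (x k) \<le> 1" using x k by (auto simp: PiE_iff)
      have "ell_norm (p k) (seq_scale (of_real (e k / 2)) (x k)) \<le> norm (of_real (e k / 2) :: 'a) * ell_norm (p k) (x k)"
        using p k xk by (intro ell_norm_seq_scale_le) auto
      also have "\<dots> \<le> e k / 2 * 1"
        using e[OF k] xk by (intro mult_mono ell_norm_nonneg) (auto simp: norm_divide)
      also have "\<dots> < e k" using e[OF k] by simp
      finally have "seq_scale (of_real (e k / 2)) (x k) \<in> W k"
        by (intro eW k seq_scale_in_ell xk)
      then show ?thesis using k by (simp add: z_def)
    qed
    then have "z \<in> PiE {1..m} W" by (auto simp: z_def PiE_iff)
    then have "N (A z) < 1" using WU by (auto simp: U_def)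
    moreover have "N (A z) = t * N (A x)"
    proof -
      have "(\<Prod>k\<in>{1..m}. norm (of_real (e k / 2) :: 'a)) = t"
        unfolding t_def
      proof (rule prod.cong[OF refl])
        show "norm (of_real (e k / 2) :: 'a) = e k / 2" if "k \<in> {1..m}" for k
          using e[OF that] by (simp add: norm_divide)
      qed
      then show ?thesis
        using dilate[OF xX, of "{1..m}" "\<lambda>k. of_real (e k / 2)"] by (simp only: z_def) simp
    qed
    ultimately show ?thesis using t by (simp add: field_simps)
  qed
  show ?thesis
    unfolding multilinear_norm_def
    by (rule cSUP_upper[OF x]) (use bound in \<open>auto intro!: bdd_aboveI\<close>)
qed

section \<open>Operators and forms as functions of lists\<close>

definition tuple :: "nat \<Rightarrow> (nat \<Rightarrow> 'a) list \<Rightarrow> nat \<Rightarrow> nat \<Rightarrow> 'a" where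
  "tuple m xs = (\<lambda>k\<in>{1..m}. xs ! (k - 1))"

lemma tuple_update: "i < m \<Longrightarrow> length xs = m \<Longrightarrow> tuple m (xs[i := u]) = (tuple m xs)(Suc i := u)"
  by (auto simp: tuple_def fun_eq_iff nth_list_update)

lemma tuple_in_PiE:
  assumes "list_all2 P xs (map p [1..<Suc m])"
  shows "tuple m xs \<in> PiE {1..m} (\<lambda>k. {u. P u (p k)})"
proof -
  have "P (xs ! (k - 1)) (p k)" if "k \<in> {1..m}" for k
  proof -
    have "k - 1 < m" "1 + (k - 1) = k" using that by auto
    then show ?thesis using list_all2_nthD2[OF assms, of "k - 1"] by (simp del: upt_Suc)
  qed
  then show ?thesis by (auto simp: tuple_def PiE_iff)
qed

lemma unit_tuple_eq: "unit_tuple m js = tuple m (unit_seqs m js)"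
  by (auto simp: unit_tuple_def tuple_def unit_seqs_def fun_eq_iff)

lemma sum_list_drop_upt:
  "(\<Sum>p\<leftarrow>drop i (map p [1..<Suc n]). real_of_ereal (1 / p)) = (\<Sum>k=Suc i..n. real_of_ereal (1 / p k))"
  by (simp add: drop_map o_def interv_sum_list_conv_sum_set_nat atLeastLessThanSuc_atLeastAtMost del: upt_Suc)

section \<open>The optimal constants\<close>

text \<open>The array \<open>A (e\<^sub>j\<^sub>1, \<dots>, e\<^sub>j\<^sub>m)\<^sub>i\<close> has one more index \<open>i\<close> than the operator has arguments; this index is summed
  innermost with exponent \<open>r\<close> and produces the \<open>\<ell>\<^sub>r\<close>-norm.\<close>

lemma operator_constants_1:
  assumes r: "2 \<le> r" and m: "1 \<le> m" and p: "\<forall>k\<in>{1..m}. ereal r < p k"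
    and lt: "(\<Sum>k=1..m. real_of_ereal (1 / p k)) < 1 / r"
    and q: "\<forall>k\<in>{1..m}. q k \<ge> r / (1 - (\<Sum>i=k..m. real_of_ereal (1 / p i)) * r)"
  shows "is_optimal_constant (operator_constants TYPE('a::{real_normed_field,real_inner}) m p q r) 1"
proof -
  define ps where "ps = map p [1..<Suc m]"
  define qs where "qs = map q [1..<Suc m]"
  have p1: "\<forall>k\<in>{1..m}. 1 \<le> p k"
    using p r by (metis dual_order.trans ereal_less_eq(3) less_imp_le one_ereal_def one_le_numeral)
  have r1: "1 \<le> ereal r" using r by (simp add: one_ereal_def)
  have len: "length ps = m" "length qs = m" by (simp_all add: ps_def qs_def)
  have qs_ne: "qs \<noteq> []" using m len by auto
  have hd_qs: "hd qs = q 1" using m by (simp add: qs_def hd_map del: upt_Suc)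
  have ps1: "\<forall>p\<in>set ps. 1 \<le> p" using p1 by (auto simp: ps_def simp del: upt_Suc)
  have crit: "crit_exponent r (drop i ps) = r / (1 - (\<Sum>k=Suc i..m. real_of_ereal (1 / p k)) * r)" for i
    unfolding ps_def crit_exponent_def sum_list_drop_upt ..
  have lt': "(\<Sum>p\<leftarrow>ps. real_of_ereal (1 / p)) * r < 1"
    using lt sum_list_drop_upt[of 0 p m] r by (simp add: ps_def field_simps del: upt_Suc)
  have "epowr (iterated_sum qs (\<lambda>js. ennreal (ell_norm (ereal r) (A (unit_tuple m js))))) (1 / q 1)
      \<le> ennreal (multilinear_norm m p (ell_norm (ereal r)) A)"
    if A: "continuous_multilinear m p (ell_topology (ereal r)) seq_scale A"
    for A :: "(nat \<Rightarrow> nat \<Rightarrow> 'a) \<Rightarrow> nat \<Rightarrow> 'a"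
  proof -
    define M where "M = multilinear_norm m p (ell_norm (ereal r)) A"
    define B where "B xs js = A (tuple m xs) (hd js)" for xs js
    have power: "(\<Sum>i. epowr (norm (y i)) r) = ennreal (ell_norm (ereal r) y powr r)"
      if "y \<in> ell (ereal r)" for y :: "nat \<Rightarrow> 'a"
    proof -
      have sm: "summable (\<lambda>i. norm (y i) powr r)" using that by (simp add: ell_def)
      have "(\<Sum>i. epowr (norm (y i)) r) = ennreal (\<Sum>i. norm (y i) powr r)"
        by (simp add: epowr_ennreal suminf_ennreal2 sm)
      also have "(\<Sum>i. norm (y i) powr r) = ell_norm (ereal r) y powr r"
        using r suminf_nonneg[OF sm] by (simp add: ell_norm_def powr_powr)
      finally show ?thesis .
    qed
    have A_ell: "A x \<in> ell (ereal r)" if "x \<in> PiE {1..m} (\<lambda>k. ell (p k))" for x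
      using continuous_multilinear_range[OF A p1 that] unfolding topspace_ell_topology[OF r1] .
    have unit_ball: "openin (ell_topology (ereal r))
        {y \<in> topspace (ell_topology (ereal r)). ell_norm (ereal r) (y :: nat \<Rightarrow> 'a) < 1}"
    proof -
      interpret Metric_space "ell (ereal r) :: (nat \<Rightarrow> 'a) set" "\<lambda>x y. \<bar>ell_norm (ereal r) (x - y)\<bar>"
        by (rule Metric_space_ell[OF r1])
      have "{y \<in> ell (ereal r). ell_norm (ereal r) (y :: nat \<Rightarrow> 'a) < 1} = mball 0 1"
        using ell_finite_support[OF r1, of 0 "0 :: nat \<Rightarrow> 'a"]
        by (auto simp: ell_norm_minus ell_norm_nonneg)
      then show ?thesis unfolding topspace_ell_topology[OF r1]
        by (simp add: ell_topology_def)
    qed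
    have upper: "ell_norm (ereal r) (A x) \<le> M"
      if "x \<in> PiE {1..m} (\<lambda>k. {u \<in> ell (p k). ell_norm (p k) u \<le> 1})" for x
      unfolding M_def
      by (rule multilinear_norm_upper[OF A m p1 _ unit_ball that])
        (simp add: topspace_ell_topology[OF r1] ell_norm_seq_scale[OF r1])
    have M: "0 \<le> M"
    proof -
      have "(unit_tuple m (replicate m 0) :: nat \<Rightarrow> nat \<Rightarrow> 'a)
          \<in> PiE {1..m} (\<lambda>k. {u \<in> ell (p k). ell_norm (p k) u \<le> 1})"
        using p1 by (auto simp: unit_tuple_def PiE_iff unit_seq_in_ell ell_norm_unit_seq_le)
      moreover from this have "A (unit_tuple m (replicate m 0)) \<in> ell (ereal r)"
        by (intro A_ell) (auto simp: PiE_iff)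
      ultimately show ?thesis using upper ell_norm_nonneg order_trans by blast
    qed
    have B: "multilinear_on ps B"
      unfolding multilinear_on_def
    proof (intro allI impI ballI)
      fix xs :: "(nat \<Rightarrow> 'a) list" and i :: nat and u v :: "nat \<Rightarrow> 'a" and c js
      assume xs: "list_all2 (\<lambda>x p. x \<in> ell p) xs ps" and i: "i < length ps"
        and uv: "u \<in> ell (ps ! i)" "v \<in> ell (ps ! i)"
      have "tuple m xs \<in> PiE {1..m} (\<lambda>k. ell (p k))"
        using tuple_in_PiE[of "\<lambda>x p. x \<in> ell p" xs p m] xs by (simp add: ps_def)
      moreover have "ps ! i = p (Suc i)" "Suc i \<in> {1..m}"
        using i by (auto simp: ps_def simp del: upt_Suc)
      moreover have "length xs = m" "i < m" using list_all2_lengthD[OF xs] i len by auto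
      ultimately show "B (xs[i := u + v]) js = B (xs[i := u]) js + B (xs[i := v]) js \<and>
          B (xs[i := seq_scale c u]) js = c * B (xs[i := u]) js"
        using A uv by (simp add: continuous_multilinear_def B_def tuple_update seq_scale_def)
    qed
    have "iterated_sum (crit_exponents r ps)
        (\<lambda>js. norm (B (unit_seqs (length ps) js) (drop (length ps) js)))
      \<le> ennreal (M powr crit_exponent r ps)"
    proof (rule multilinear_bound[OF r ps1 lt' M B])
      fix xs :: "(nat \<Rightarrow> 'a) list"
      assume "list_all2 (\<lambda>x p. x \<in> ell p \<and> ell_norm p x \<le> 1) xs ps"
      then have ball: "tuple m xs \<in> PiE {1..m} (\<lambda>k. {u \<in> ell (p k). ell_norm (p k) u \<le> 1})"
        unfolding ps_def by (rule tuple_in_PiE)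
      then have in_ell: "A (tuple m xs) \<in> ell (ereal r)" by (intro A_ell) (auto simp: PiE_iff)
      have "ell_norm (ereal r) (A (tuple m xs)) powr r \<le> M powr r"
        using upper[OF ball] ell_norm_nonneg[OF in_ell] r by (intro powr_mono2) auto
      then show "(\<Sum>j. epowr (norm (B xs [j])) r) \<le> ennreal (M powr r)"
        by (simp add: B_def power[OF in_ell] ennreal_leI)
    qed
    \<comment> \<open>At \<open>i = m\<close> this compares \<open>r\<close> with itself: the exponent of the target is not enlarged.\<close>
    moreover have "crit_exponent r (drop i ps) \<le> (qs @ [r]) ! i" if "i \<le> length ps" for i
    proof (cases "i < m")
      case True
      then show ?thesis unfolding crit using q by (simp add: qs_def nth_append del: upt_Suc)
    next
      case False
      with that have "i = m" by (simp add: len)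
      then show ?thesis by (simp add: crit_exponent_def nth_append len)
    qed
    ultimately have "epowr (iterated_sum (qs @ [r])
        (\<lambda>js. norm (B (unit_seqs (length ps) js) (drop (length ps) js)))) (1 / hd (qs @ [r])) \<le> ennreal M"
      by (intro iterated_norm_le_of_crit[OF r ps1 lt' M]) (auto simp: len)
    moreover have "iterated_sum (qs @ [r]) (\<lambda>js. norm (B (unit_seqs (length ps) js) (drop (length ps) js)))
      = iterated_sum qs (\<lambda>js. ennreal (ell_norm (ereal r) (A (unit_tuple m js))))"
    proof -
      have "epowr (\<Sum>i. epowr (norm (B (unit_seqs m (js @ [i])) (drop m (js @ [i])))) r) (1 / r)
          = ennreal (ell_norm (ereal r) (A (unit_tuple m js)))" if "length js = length qs" for js
      proof -
        have "unit_tuple m js \<in> PiE {1..m} (\<lambda>k. ell (p k))"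
          using p1 by (auto simp: unit_tuple_def PiE_iff unit_seq_in_ell)
        then have in_ell: "A (unit_tuple m js) \<in> ell (ereal r)" by (rule A_ell)
        have "unit_seqs m (js @ [i]) = (unit_seqs m js :: (nat \<Rightarrow> 'a) list)" for i
          using that len by (auto simp: unit_seqs_def nth_append)
        then have entry: "B (unit_seqs m (js @ [i])) (drop m (js @ [i])) = A (unit_tuple m js) i" for i
          using that len by (simp add: B_def unit_tuple_eq)
        show ?thesis
          unfolding entry power[OF in_ell]
          using r ell_norm_nonneg[OF in_ell] by (simp add: epowr_ennreal powr_powr)
      qed
      then show ?thesis
        using r by (auto simp: iterated_sum_snoc[OF qs_ne] len intro: iterated_sum_cong)
    qed
    ultimately show ?thesis using qs_ne by (simp add: hd_qs M_def)
  qed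
  then have "1 \<in> operator_constants TYPE('a) m p q r"
    by (simp add: operator_constants_def admissible_constants_def qs_def del: upt_Suc)
  then show ?thesis
    by (auto simp: is_optimal_constant_def operator_constants_def admissible_constants_def)
qed

text \<open>Put \<open>r = 1 / (1 - 1 / p\<^sub>m)\<close>, the conjugate exponent of \<open>p\<^sub>m\<close>; it is at least \<open>2\<close> because \<open>p\<^sub>m \<le> 2\<close>. By
  \<open>functional_coefficients\<close> in the last argument, the form is an \<open>(m - 1)\<close>-linear operator into \<open>\<ell>\<^sub>r\<close> of no
  larger norm, and its critical exponents for the target \<open>\<ell>\<^sub>r\<close> are those required of the form.\<close>

lemma form_constants_1:
  assumes m: "2 \<le> m" and pm: "1 < p m" "p m \<le> 2" and p: "\<forall>k\<in>{1..<m}. 2 < p k"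
    and lt: "(\<Sum>k=1..m. real_of_ereal (1 / p k)) < 1"
    and q: "\<forall>k\<in>{1..m}. q k \<ge> 1 / (1 - (\<Sum>i=k..m. real_of_ereal (1 / p i)))"
  shows "is_optimal_constant (form_constants TYPE('a::{real_normed_field,real_inner}) m p q) 1"
proof -
  define P where "P = real_of_ereal (1 / p m)"
  define r where "r = 1 / (1 - P)"
  obtain n where n: "m = Suc n" "1 \<le> n" using m by (cases m) auto
  define ps where "ps = map p [1..<m]"
  define qs where "qs = map q [1..<Suc m]"
  have P: "1 / 2 \<le> P" "P < 1"
    using pm unfolding P_def by (cases "p m"; simp add: one_ereal_def)+
  have r: "2 \<le> r" "0 < 1 - P" using P by (auto simp: r_def field_simps)
  have p1: "\<forall>k\<in>{1..m}. 1 \<le> p k"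
  proof
    fix k assume "k \<in> {1..m}"
    then consider "k = m" | "k \<in> {1..<m}" by fastforce
    then show "1 \<le> p k"
    proof cases
      case 2
      then have "2 < p k" using p by blast
      then show ?thesis by (cases "p k") (auto simp: one_ereal_def)
    qed (use pm in simp)
  qed
  have pm1: "1 \<le> p m" using pm by simp
  have len: "length ps = n" "length qs = m" by (simp_all add: ps_def qs_def n)
  have ps_snoc: "map p [1..<Suc m] = ps @ [p m]" using m by (simp add: ps_def)
  have qs_ne: "qs \<noteq> []" using m len by auto
  have hd_qs: "hd qs = q 1" using m by (simp add: qs_def hd_map del: upt_Suc)
  have ps1: "\<forall>p\<in>set ps. 1 \<le> p" using p1 by (auto simp: ps_def)
  have tail: "(\<Sum>k=Suc i..m. real_of_ereal (1 / p k)) = (\<Sum>p\<leftarrow>drop i ps. real_of_ereal (1 / p)) + P"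
    if "i < m" for i
    using that sum_list_drop_upt[of i p m] len n unfolding ps_snoc by (simp add: P_def)
  have crit: "crit_exponent r (drop i ps) = 1 / (1 - (\<Sum>k=Suc i..m. real_of_ereal (1 / p k)))"
    if "i < m" for i
    unfolding crit_exponent_def tail[OF that] using r(2) by (simp add: r_def field_simps)
  have lt': "(\<Sum>p\<leftarrow>ps. real_of_ereal (1 / p)) * r < 1"
    using lt tail[of 0] m r(2) by (simp add: r_def field_simps)
  have "epowr (iterated_sum qs (\<lambda>js. ennreal (norm (A (unit_tuple m js))))) (1 / q 1)
      \<le> ennreal (multilinear_norm m p norm A)"
    if A: "continuous_multilinear m p euclidean (*) A"
    for A :: "(nat \<Rightarrow> nat \<Rightarrow> 'a) \<Rightarrow> 'a"
  proof -
    define M where "M = multilinear_norm m p norm A"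
    define B where "B xs js = A (tuple m (xs @ [unit_seq (hd js)]))" for xs js
    have "openin euclidean {y \<in> topspace euclidean. norm (y :: 'a) < 1}"
      using open_Collect_less[of norm "\<lambda>_. 1 :: real"] by (simp add: continuous_on_norm_id)
    then have upper: "norm (A x) \<le> M"
      if "x \<in> PiE {1..m} (\<lambda>k. {u \<in> ell (p k). ell_norm (p k) u \<le> 1})" for x
      unfolding M_def using m
      by (intro multilinear_norm_upper[OF A _ p1 _ _ that]) (auto simp: norm_mult)
    have "(unit_tuple m (replicate m 0) :: nat \<Rightarrow> nat \<Rightarrow> 'a)
        \<in> PiE {1..m} (\<lambda>k. {u \<in> ell (p k). ell_norm (p k) u \<le> 1})"
      using p1 by (auto simp: unit_tuple_def PiE_iff unit_seq_in_ell ell_norm_unit_seq_le)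
    then have M: "0 \<le> M" using upper norm_ge_zero order_trans by blast
    have linear: "A (tuple m (xs[i := u + v])) = A (tuple m (xs[i := u])) + A (tuple m (xs[i := v]))"
      "A (tuple m (xs[i := seq_scale c u])) = c * A (tuple m (xs[i := u]))"
      if xs: "list_all2 (\<lambda>x p. x \<in> ell p) xs (map p [1..<Suc m])" and i: "i < m"
        and uv: "u \<in> ell (p (Suc i))" "v \<in> ell (p (Suc i))" for xs i u v c
    proof -
      have "tuple m xs \<in> PiE {1..m} (\<lambda>k. ell (p k))"
        using tuple_in_PiE[OF xs] by simp
      moreover have "length xs = m" using list_all2_lengthD[OF xs] by (simp del: upt_Suc)
      ultimately show "A (tuple m (xs[i := u + v])) = A (tuple m (xs[i := u])) + A (tuple m (xs[i := v]))"
        "A (tuple m (xs[i := seq_scale c u])) = c * A (tuple m (xs[i := u]))"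
        using A uv i by (simp_all add: continuous_multilinear_def tuple_update)
    qed
    have snoc: "list_all2 (\<lambda>x p. x \<in> ell p) (xs @ [u]) (map p [1..<Suc m])"
      if "list_all2 (\<lambda>x p. x \<in> ell p) xs ps" "u \<in> ell (p m)" for xs and u :: "nat \<Rightarrow> 'a"
      unfolding ps_snoc using that by (auto intro: list_all2_appendI)
    have B: "multilinear_on ps B"
      unfolding multilinear_on_def
    proof (intro allI impI ballI)
      fix xs :: "(nat \<Rightarrow> 'a) list" and i :: nat and u v :: "nat \<Rightarrow> 'a" and c js
      assume xs: "list_all2 (\<lambda>x p. x \<in> ell p) xs ps" and i: "i < length ps"
        and uv: "u \<in> ell (ps ! i)" "v \<in> ell (ps ! i)"
      have upd: "xs[i := w] @ [unit_seq (hd js)] = (xs @ [unit_seq (hd js)])[i := w]" for w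
        using list_all2_lengthD[OF xs] i by (simp add: list_update_append1)
      have "ps ! i = p (Suc i)" "i < m" using i len n by (auto simp: ps_def simp del: upt_Suc)
      then show "B (xs[i := u + v]) js = B (xs[i := u]) js + B (xs[i := v]) js \<and>
          B (xs[i := seq_scale c u]) js = c * B (xs[i := u]) js"
        unfolding B_def upd using uv
        by (intro conjI linear snoc[OF xs unit_seq_in_ell[OF pm1]]) auto
    qed
    have "iterated_sum (crit_exponents r ps)
        (\<lambda>js. norm (B (unit_seqs (length ps) js) (drop (length ps) js)))
      \<le> ennreal (M powr crit_exponent r ps)"
    proof (rule multilinear_bound[OF r(1) ps1 lt' M B])
      fix xs :: "(nat \<Rightarrow> 'a) list"
      assume ball: "list_all2 (\<lambda>x p. x \<in> ell p \<and> ell_norm p x \<le> 1) xs ps"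
      then have xs: "list_all2 (\<lambda>x p. x \<in> ell p) xs ps" by (rule list_all2_mono) simp
      have upd: "xs @ [w] = (xs @ [0])[n := w]" for w
        using list_all2_lengthD[OF xs] len by (simp add: list_update_append)
      have xs0: "list_all2 (\<lambda>x p. x \<in> ell p) (xs @ [0]) (map p [1..<Suc m])"
        by (rule snoc[OF xs]) (simp add: ell_finite_support[OF pm1, of 0])
      have "(\<Sum>j. epowr (norm (A (tuple m (xs @ [unit_seq j])))) r) \<le> ennreal (M powr r)"
        unfolding r_def P_def
      proof (rule functional_coefficients[OF pm1 _ _ _ M, where G = "\<lambda>u. A (tuple m (xs @ [u]))"])
        show "A (tuple m (xs @ [u + v])) = A (tuple m (xs @ [u])) + A (tuple m (xs @ [v]))"
          if "u \<in> ell (p m)" "v \<in> ell (p m)" for u v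
          using linear(1)[OF xs0, of n u v] that by (simp add: n upd[symmetric])
        show "A (tuple m (xs @ [seq_scale c u])) = c * A (tuple m (xs @ [u]))"
          if "u \<in> ell (p m)" for u c
          using linear(2)[OF xs0, of n u u c] that by (simp add: n upd[symmetric])
        show "norm (A (tuple m (xs @ [u]))) \<le> M" if "u \<in> ell (p m)" "ell_norm (p m) u \<le> 1" for u
        proof (rule upper, rule tuple_in_PiE)
          show "list_all2 (\<lambda>x p. x \<in> ell p \<and> ell_norm p x \<le> 1) (xs @ [u]) (map p [1..<Suc m])"
            unfolding ps_snoc using ball that by (auto intro: list_all2_appendI)
        qed
      qed (use P in \<open>simp add: P_def\<close>)
      then show "(\<Sum>j. epowr (norm (B xs [j])) r) \<le> ennreal (M powr r)"
        by (simp add: B_def)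
    qed
    then have "epowr (iterated_sum qs
        (\<lambda>js. norm (B (unit_seqs (length ps) js) (drop (length ps) js)))) (1 / hd qs) \<le> ennreal M"
    proof (rule iterated_norm_le_of_crit[OF r(1) ps1 lt' M])
      fix i assume "i \<le> length ps"
      then have "i < m" using len n by simp
      then show "crit_exponent r (drop i ps) \<le> qs ! i"
        unfolding crit[OF \<open>i < m\<close>] using q by (simp add: qs_def del: upt_Suc)
    qed (simp add: len n)
    moreover have "B (unit_seqs n js) (drop n js) = A (unit_tuple m js)" if "length js = m" for js
    proof -
      have "unit_seqs n js @ [unit_seq (hd (drop n js))] = (unit_seqs m js :: (nat \<Rightarrow> 'a) list)"
        using that n by (simp add: unit_seqs_def hd_drop_conv_nth)
      then show ?thesis by (simp add: B_def unit_tuple_eq)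
    qed
    then have "iterated_sum qs (\<lambda>js. norm (B (unit_seqs (length ps) js) (drop (length ps) js)))
      = iterated_sum qs (\<lambda>js. ennreal (norm (A (unit_tuple m js))))"
      unfolding len by (intro iterated_sum_cong) (simp add: len)
    ultimately show ?thesis by (simp add: hd_qs M_def)
  qed
  then have "1 \<in> form_constants TYPE('a) m p q"
    by (simp add: form_constants_def admissible_constants_def qs_def del: upt_Suc)
  then show ?thesis
    by (auto simp: is_optimal_constant_def form_constants_def admissible_constants_def)
qed

theorem mainTheorem3:
  shows "(\<forall>(r::real) (m::nat) (p::nat \<Rightarrow> ereal) (q::nat \<Rightarrow> real).
            2 \<le> r \<and> 1 \<le> m \<and>
            (\<forall>k\<in>{1..m}. ereal r < p k) \<and>
            (\<Sum>k=1..m. real_of_ereal (1 / p k)) < 1 / r \<and>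
            (\<forall>k\<in>{1..m}. 0 < q k) \<and>
            (\<forall>k\<in>{1..m}. q k \<ge> r / (1 - (\<Sum>i=k..m. real_of_ereal (1 / p i)) * r))
            \<longrightarrow> is_optimal_constant (operator_constants TYPE(real) m p q r) 1 \<and>
                is_optimal_constant (operator_constants TYPE(complex) m p q r) 1)
       \<and> (\<forall>(m::nat) (p::nat \<Rightarrow> ereal) (q::nat \<Rightarrow> real).
            2 \<le> m \<and>
            1 < p m \<and> p m \<le> 2 \<and> (\<forall>k\<in>{1..<m}. 2 < p k) \<and>
            (\<Sum>k=1..m. real_of_ereal (1 / p k)) < 1 \<and>
            (\<forall>k\<in>{1..m}. 0 < q k) \<and>
            (\<forall>k\<in>{1..m}. q k \<ge> 1 / (1 - (\<Sum>i=k..m. real_of_ereal (1 / p i))))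
            \<longrightarrow> is_optimal_constant (form_constants TYPE(real) m p q) 1 \<and>
                is_optimal_constant (form_constants TYPE(complex) m p q) 1)"
  by (intro conjI allI impI operator_constants_1 form_constants_1) auto
end
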